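(* Let $A>0$ be a constant. Then there is a constant $T_0(A)$ depending only on $A$ such that $$ \frac1T\int_T^{2T}|\zeta(1+it;y)|^{2k}\,dt=D_k(y)\bigg\{1+O_A\bigg(\exp\bigg\{-\frac{\log T}{2(\log_2T)^4}\bigg\}\bigg)\bigg\} $$ uniformly for $T\ge T_0(A)$, real $y$ with $e^2\log T\le y\le(\log T)(\log_2T)^{A}$, and integers $k$ with $2\le k\le \dfrac{\log T}{e^{10}\log(y/\log T)}$, where the implied constant depends on $A$ only.
   Context: $\log_2T=\log\log T$. The short Euler product is $\zeta(s;y):=\prod_{p\le y}(1-p^{-s})^{-1}$ (product over primes). For a positive integer $k$, $d_k(n)$ is defined by $\zeta(s)^k=\sum_{n\ge1}d_k(n)n^{-s}$ for $\mathrm{Re}\,s>1$, where $\zeta(s)$ is the Riemann zeta function. $S(y)$ denotes the set of $y$-friable positive integers, i.e. those all of whose prime factors are $\le y$ (with $1\in S(y)$), and $$D_k(y):=\sum_{n\in S(y)}\frac{d_k(n)^2}{n^2}.$$ *)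

theory Defs
  imports "HOL-Analysis.Analysis" "HOL-Computational_Algebra.Primes"
begin

definition short_euler_product :: "real \<Rightarrow> complex \<Rightarrow> complex" where
  "short_euler_product y s =
     (\<Prod>p | prime p \<and> real p \<le> y. inverse (1 - of_nat p powr (- s)))"

(* Only meaningful on the half-plane Re s > 1, where the Dirichlet series converges absolutely. *)
definition zeta :: "complex \<Rightarrow> complex" where
  "zeta s = (\<Sum>\<^sub>\<infinity>n\<in>{1::nat..}. of_nat n powr (- s))"

definition zeta_power_coeffs :: "nat \<Rightarrow> (nat \<Rightarrow> real) \<Rightarrow> bool" where
  "zeta_power_coeffs k d \<longleftrightarrow> d 0 = 0 \<and>
     (\<forall>s. Re s > 1 \<longrightarrow>
        ((\<lambda>n. of_real (d n) * of_nat n powr (- s)) has_sum zeta s ^ k) {1..})"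

(* The k-fold divisor function. The requirement d 0 = 0 in zeta_power_coeffs only fixes the
   value at the irrelevant index 0; existence and uniqueness are proved in
   ex1_zeta_power_coeffs below. *)
definition divisor_fun :: "nat \<Rightarrow> nat \<Rightarrow> real" where
  "divisor_fun k = (THE d. zeta_power_coeffs k d)"

definition friable :: "real \<Rightarrow> nat set" where
  "friable y = {n. n > 0 \<and> (\<forall>p. prime p \<and> p dvd n \<longrightarrow> real p \<le> y)}"

(* The series converges for all k and y, as d_k(n) grows slower than any power of n, so the
   default value of infsum never occurs. *)
definition friable_divisor_sum :: "nat \<Rightarrow> real \<Rightarrow> real" where
  "friable_divisor_sum k y = (\<Sum>\<^sub>\<infinity>n\<in>friable y. (divisor_fun k n)\<^sup>2 / (real n)\<^sup>2)"

lemma has_sum_zeta: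
  assumes "Re s > 1"
  shows "((\<lambda>n. of_nat n powr (- s)) has_sum zeta s) {1::nat..}"
proof -
  have "(\<lambda>n. norm ((of_nat n :: complex) powr (- s))) = (\<lambda>n. real n powr (- Re s))"
    by (auto simp: fun_eq_iff norm_powr_real_powr)
  hence "summable (\<lambda>n. norm ((of_nat n :: complex) powr (- s)))"
    using assms by (simp add: summable_real_powr_iff)
  hence "(\<lambda>n::nat. (of_nat n :: complex) powr (- s)) summable_on UNIV"
    by (rule norm_summable_imp_summable_on)
  hence "(\<lambda>n::nat. (of_nat n :: complex) powr (- s)) summable_on {1..}"
    by (rule summable_on_subset_banach) auto
  thus ?thesis
    unfolding zeta_def by (rule has_sum_infsum)
qed

lemma zeta_power_coeffs_0: "zeta_power_coeffs 0 (\<lambda>n. if n = 1 then 1 else 0)"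
proof -
  have "((\<lambda>n. of_real (if n = 1 then 1 else 0) * of_nat n powr (- s)) has_sum (1::complex)) {1..}"
    for s
  proof -
    have "((\<lambda>n. of_real (if n = 1 then 1 else 0) * of_nat n powr (- s)) has_sum
             (\<Sum>n\<in>{1::nat}. of_real (if n = 1 then 1 else 0) * of_nat n powr (- s) :: complex)) {1}"
      by (rule has_sum_finite) auto
    hence "((\<lambda>n. of_real (if n = 1 then 1 else 0) * of_nat n powr (- s)) has_sum (1::complex)) {1::nat}"
      by simp
    thus ?thesis
      by (subst has_sum_cong_neutral[where T = "{1}"]) auto
  qed
  thus ?thesis by (simp add: zeta_power_coeffs_def)
qed

lemma zeta_power_coeffs_Suc:
  assumes "zeta_power_coeffs k d"
  shows "zeta_power_coeffs (Suc k) (\<lambda>n. if n = 0 then 0 else \<Sum>m | m dvd n. d m)"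
    (is "zeta_power_coeffs _ ?d'")
proof -
  have "((\<lambda>n. of_real (?d' n) * of_nat n powr (- s)) has_sum zeta s ^ Suc k) {1..}"
    if s: "Re s > 1" for s :: complex
  proof -
    define f g where "f = (\<lambda>n::nat. of_real (d n) * of_nat n powr (- s) :: complex)"
      and "g = (\<lambda>n::nat. of_nat n powr (- s) :: complex)"
    have f: "(f has_sum zeta s ^ k) {1..}"
      using assms s by (simp add: zeta_power_coeffs_def f_def)
    have g: "(g has_sum zeta s) {1..}"
      using has_sum_zeta[OF s] by (simp add: g_def)
    define G where "G = (\<Sum>\<^sub>\<infinity>l\<in>{1..}. norm (g l))"
    have nf: "(\<lambda>m. norm (f m)) summable_on {1..}" and ng: "(\<lambda>l. norm (g l)) summable_on {1..}"
      using f g by (auto simp flip: summable_on_iff_abs_summable_on_complex dest: has_sum_imp_summable)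
    have "(\<lambda>(m, l). norm (f m) * norm (g l)) summable_on {1..} \<times> {1..}"
    proof (rule summable_on_SigmaI)
      show "((\<lambda>l. case (m, l) of (m, l) \<Rightarrow> norm (f m) * norm (g l)) has_sum norm (f m) * G) {1..}" for m
        using has_sum_cmult_right[OF has_sum_infsum[OF ng]] by (simp add: G_def)
      show "(\<lambda>m. norm (f m) * G) summable_on {1..}"
        by (rule summable_on_cmult_left[OF nf])
    qed auto
    hence "(\<lambda>(m, l). f m * g l) summable_on {1..} \<times> {1..}"
      using abs_summable_summable[of "\<lambda>(m, l). f m * g l" "{1..} \<times> {1..}"]
      by (simp add: case_prod_unfold norm_mult)
    hence prod: "((\<lambda>(m, l). f m * g l) has_sum zeta s ^ k * zeta s) ({1..} \<times> {1..})"
      using has_sum_cmult_right[OF g] has_sum_cmult_left[OF f]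
      by (intro has_sum_SigmaI[where g = "\<lambda>m. f m * zeta s"]) simp_all
    also have "?this \<longleftrightarrow>
        ((\<lambda>(n, m). f m * g (n div m)) has_sum zeta s ^ Suc k) (SIGMA n:{1..}. {m. m dvd n})"
      by (rule has_sum_reindex_bij_witness[where
            i = "\<lambda>(n, m). (m, n div m)" and j = "\<lambda>(m, l). (m * l, m)"])
         (auto simp: Suc_le_eq mult.commute elim!: dvdE)
    finally have "((\<lambda>n. \<Sum>m | m dvd n. f m * g (n div m)) has_sum zeta s ^ Suc k) {1..}"
      by (rule has_sum_SigmaD) (auto intro!: has_sum_finite)
    also have "?this \<longleftrightarrow> ?thesis"
    proof (rule has_sum_cong)
      fix n :: nat assume "n \<in> {1..}"
      hence n: "n > 0" by simp
      have "f m * g (n div m) = of_real (d m) * of_nat n powr (- s)" if mn: "m dvd n" for m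
      proof -
        obtain l where l: "n = m * l" using mn by (elim dvdE)
        have "(of_nat (m * l) :: complex) powr (- s) = of_nat m powr (- s) * of_nat l powr (- s)"
          unfolding of_nat_mult by (rule powr_times_real) auto
        with l n show ?thesis by (simp add: f_def g_def)
      qed
      thus "(\<Sum>m | m dvd n. f m * g (n div m)) = of_real (?d' n) * of_nat n powr (- s)"
        using n by (simp add: sum_distrib_right)
    qed
    finally show ?thesis .
  qed
  thus ?thesis by (simp add: zeta_power_coeffs_def)
qed

lemma dirichlet_series_coeffs_eq_0:
  fixes c :: "nat \<Rightarrow> real"
  assumes c: "\<And>s. Re s > 1 \<Longrightarrow> ((\<lambda>n. of_real (c n) * of_nat n powr (- s)) has_sum (0::complex)) {1..}"
  assumes "N > 0"
  shows "c N = 0"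
  using \<open>N > 0\<close>
proof (induction N rule: less_induct)
  case (less N)
  define F where "F = (\<lambda>s n. of_real (c n) * of_nat n powr (- s) :: complex)"
  have norm_F: "norm (F (of_real x) n) = \<bar>c n\<bar> * real n powr (- x)" for x n
    by (simp add: F_def norm_mult norm_powr_real_powr)
  define K where "K = (\<Sum>\<^sub>\<infinity>n\<in>{N<..}. \<bar>c n\<bar> * real n powr (- 2))"
  have summ: "(\<lambda>n. \<bar>c n\<bar> * real n powr (- x)) summable_on {N<..}" if "x > 1" for x
  proof -
    have "F (of_real x) summable_on {1..}"
      using c[of "of_real x"] that by (auto simp: F_def dest: has_sum_imp_summable)
    hence "F (of_real x) summable_on {N<..}"
      by (rule summable_on_subset_banach) auto
    thus ?thesis
      by (simp add: summable_on_iff_abs_summable_on_complex norm_F)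
  qed
  have bound: "\<bar>c N\<bar> \<le> real N ^ 2 * K * (real N / real (Suc N)) ^ j" for j :: nat
  proof -
    define x where "x = real (j + 2)"
    have x: "x > 1" by (simp add: x_def)
    have "(F (of_real x) has_sum 0) {1..}"
      using c[of "of_real x"] x by (simp add: F_def)
    also have "?this \<longleftrightarrow> (F (of_real x) has_sum 0) {N..}"
      using less by (intro has_sum_cong_neutral) (auto simp: F_def)
    finally have 1: "(F (of_real x) has_sum 0) {N..}" .
    have "(F (of_real x) has_sum (0 - F (of_real x) N)) ({N..} - {N})"
      by (rule has_sum_Diff[OF 1]) (auto simp: has_sum_finite_iff)
    also have "{N..} - {N} = {N<..}" by auto
    finally have 2: "(F (of_real x) has_sum (- F (of_real x) N)) {N<..}" by simp
    have le: "\<bar>c n\<bar> * real n powr (- x) \<le> real (Suc N) powr (- real j) * (\<bar>c n\<bar> * real n powr (- 2))"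
      if "n > N" for n
    proof -
      have "real n powr (- x) = real n powr (- real j) * real n powr (- 2)"
        by (simp add: x_def algebra_simps flip: powr_add)
      moreover have "real n powr (- real j) \<le> real (Suc N) powr (- real j)"
        using that by (intro powr_mono2') auto
      ultimately have "real n powr (- x) \<le> real (Suc N) powr (- real j) * real n powr (- 2)"
        by (simp add: mult_right_mono)
      from mult_left_mono[OF this, of "\<bar>c n\<bar>"] show ?thesis by (simp add: mult_ac)
    qed
    have "\<bar>c N\<bar> * real N powr (- x) = norm (infsum (F (of_real x)) {N<..})"
      using infsumI[OF 2] by (simp add: norm_F)
    also have "\<dots> \<le> (\<Sum>\<^sub>\<infinity>n\<in>{N<..}. norm (F (of_real x) n))"
      using summ[OF x] by (intro norm_infsum_bound) (simp add: norm_F)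
    also have "\<dots> \<le> (\<Sum>\<^sub>\<infinity>n\<in>{N<..}. real (Suc N) powr (- real j) * (\<bar>c n\<bar> * real n powr (- 2)))"
      using summ[OF x] summ[of 2] le
      by (intro infsum_mono) (auto simp: norm_F intro!: summable_on_cmult_right)
    also have "\<dots> = real (Suc N) powr (- real j) * K"
      unfolding K_def using summ[of 2] by (intro infsum_cmult_right) auto
    finally have 3: "\<bar>c N\<bar> * real N powr (- x) \<le> real (Suc N) powr (- real j) * K" .
    have N: "real N > 0" using less by simp
    have "real N powr (- x) * real N ^ (j + 2) = 1"
      unfolding x_def powr_minus powr_realpow[OF N] using N by (intro left_inverse) simp
    hence "\<bar>c N\<bar> = (\<bar>c N\<bar> * real N powr (- x)) * real N ^ (j + 2)"
      by (simp only: mult.assoc mult_1_right)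
    also have "\<dots> \<le> (real (Suc N) powr (- real j) * K) * real N ^ (j + 2)"
      using 3 by (rule mult_right_mono) auto
    also have "\<dots> = real N ^ 2 * K * (real N / real (Suc N)) ^ j"
    proof -
      have "real (Suc N) powr (- real j) = inverse (real (Suc N) ^ j)"
        unfolding powr_minus by (subst powr_realpow) auto
      thus ?thesis by (simp only: power_add power_mult_distrib power_inverse divide_inverse mult_ac)
    qed
    finally show ?thesis .
  qed
  have "(\<lambda>j. real N ^ 2 * K * (real N / real (Suc N)) ^ j) \<longlonglongrightarrow> real N ^ 2 * K * 0"
    by (intro tendsto_intros LIMSEQ_power_zero) auto
  hence "\<bar>c N\<bar> \<le> real N ^ 2 * K * 0"
    by (rule LIMSEQ_le_const) (use bound in auto)
  thus ?case by simp
qed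

lemma zeta_power_coeffs_unique:
  assumes "zeta_power_coeffs k d" "zeta_power_coeffs k e"
  shows "d = e"
proof
  fix n
  show "d n = e n"
  proof (cases "n = 0")
    case True
    thus ?thesis using assms by (simp add: zeta_power_coeffs_def)
  next
    case False
    have "d n - e n = 0"
    proof (rule dirichlet_series_coeffs_eq_0)
      fix s :: complex assume s: "Re s > 1"
      have "((\<lambda>n. of_real (d n) * of_nat n powr (- s) + - (of_real (e n) * of_nat n powr (- s)))
               has_sum (zeta s ^ k + - (zeta s ^ k))) {1..}"
        using assms s by (intro has_sum_add has_sum_uminusI) (auto simp: zeta_power_coeffs_def)
      thus "((\<lambda>n. of_real (d n - e n) * of_nat n powr (- s)) has_sum 0) {1..}"
        by (simp add: ring_distribs)
    qed (use False in simp)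
    thus ?thesis by simp
  qed
qed

lemma ex1_zeta_power_coeffs: "\<exists>!d. zeta_power_coeffs k d"
proof -
  have "\<exists>d. zeta_power_coeffs k d"
    by (induction k) (blast intro: zeta_power_coeffs_0 zeta_power_coeffs_Suc)+
  thus ?thesis using zeta_power_coeffs_unique by blast
qed

lemma zeta_power_coeffs_divisor_fun: "zeta_power_coeffs k (divisor_fun k)"
  unfolding divisor_fun_def by (rule theI'[OF ex1_zeta_power_coeffs])

end

theory Submission
  imports Defs "HOL-Real_Asymp.Real_Asymp"
begin

text \<open>
  Put \<open>L = ln T\<close>, \<open>l = ln L\<close>. On the line \<open>Re s = 1\<close> every Euler factor has a Fourier expansion
  \<open>\<bar>1 - p powr (- 1 - i t)\<bar> ^ (- 2 k) = (\<Sum>j. c\<^sub>p(j) * exp (i j t ln p))\<close> with nonnegative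
  coefficients, and \<open>D\<^sub>k(y)\<close> is the product of the central coefficients \<open>c\<^sub>p(0)\<close>. Expanding the whole
  product is useless, since the typical integers in it have size \<open>exp (k ln k)\<close>, far beyond \<open>T\<close>. But
  \<open>c\<^sub>p(j)\<close> is essentially a Gaussian of width \<open>sqrt (k / p)\<close> in \<open>j\<close>, so after cancelling common
  factors the frequencies are much smaller. The primes are split into the dyadic blocks below \<open>k\<close> and one
  block of the primes between \<open>k\<close> and \<open>y\<close>. By Rankin's trick the expansion of a block may be truncated
  to \<open>(\<Sum>p. \<bar>j\<^sub>p\<bar> * ln p) \<le> w * L\<close> with a pointwise error of at most \<open>exp (- L / l ^ 4)\<close> times the mean of
  the block, where the weights \<open>w\<close> add up to less than 1/2. A product of truncated blocks is a trigonometric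
  polynomial whose nonzero frequencies are at least \<open>exp (- L / 2)\<close>, so its mean over \<open>[T, 2 T]\<close> is
  close to its constant term. Raising each truncation by its error gives majorants \<open>g\<close> of the blocks
  \<open>f\<close>, and \<open>0 \<le> (\<Prod>g) - (\<Prod>f) \<le> (\<Sum>i. (g\<^sub>i - f\<^sub>i) * (\<Prod>j\<noteq>i. g\<^sub>j))\<close> finishes the proof.
\<close>

section \<open>Infinite sums over products\<close>

lemma abs_summable_on_Times:
  fixes f :: "'a \<Rightarrow> 'c::real_normed_field" and g :: "'b \<Rightarrow> 'c"
  assumes "f abs_summable_on A" "g abs_summable_on B"
  shows "(\<lambda>(x, y). f x * g y) abs_summable_on A \<times> B"
proof -
  have "(\<lambda>(x, y). norm (f x) * norm (g y)) summable_on A \<times> B"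
  proof (rule summable_on_SigmaI)
    show "((\<lambda>y. case (x, y) of (x, y) \<Rightarrow> norm (f x) * norm (g y)) has_sum
            norm (f x) * infsum (\<lambda>y. norm (g y)) B) B" for x
      using has_sum_cmult_right[OF has_sum_infsum[OF assms(2)]] by simp
    show "(\<lambda>x. norm (f x) * infsum (\<lambda>y. norm (g y)) B) summable_on A"
      by (rule summable_on_cmult_left[OF assms(1)])
  qed auto
  thus ?thesis by (simp add: case_prod_unfold norm_mult)
qed

lemma has_sum_product:
  fixes f :: "'a \<Rightarrow> 'c::{real_normed_field, banach}" and g :: "'b \<Rightarrow> 'c"
  assumes "f abs_summable_on A" "g abs_summable_on B" "(f has_sum a) A" "(g has_sum b) B"
  shows "((\<lambda>(x, y). f x * g y) has_sum a * b) (A \<times> B)"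
proof (rule has_sum_SigmaI[where g = "\<lambda>x. f x * b"])
  show "((\<lambda>y. case (x, y) of (x, y) \<Rightarrow> f x * g y) has_sum f x * b) B" for x
    using has_sum_cmult_right[OF assms(4)] by simp
  show "((\<lambda>x. f x * b) has_sum a * b) A"
    by (rule has_sum_cmult_left[OF assms(3)])
  show "(\<lambda>(x, y). f x * g y) summable_on A \<times> B"
    by (rule abs_summable_summable[OF abs_summable_on_Times[OF assms(1,2)]])
qed

text \<open>Multiplies out a finite product of absolutely convergent series, one factor at a time.
  Absolute summability is carried through the induction because each application of
  \<open>has_sum_product\<close> asks for it.\<close>

lemma has_sum_prod_PiE:
  fixes f :: "'a \<Rightarrow> 'b \<Rightarrow> 'c::{real_normed_field, banach}"
  assumes "finite A" "\<And>x. x \<in> A \<Longrightarrow> f x abs_summable_on B x"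
    "\<And>x. x \<in> A \<Longrightarrow> (f x has_sum S x) (B x)"
  shows "(\<lambda>g. \<Prod>x\<in>A. f x (g x)) abs_summable_on PiE A B"
    and "((\<lambda>g. \<Prod>x\<in>A. f x (g x)) has_sum (\<Prod>x\<in>A. S x)) (PiE A B)"
proof -
  have "(\<lambda>g. \<Prod>x\<in>A. f x (g x)) abs_summable_on PiE A B \<and>
        ((\<lambda>g. \<Prod>x\<in>A. f x (g x)) has_sum (\<Prod>x\<in>A. S x)) (PiE A B)"
    using assms
  proof (induction A rule: finite_induct)
    case empty
    thus ?case by (auto intro!: has_sum_finiteI)
  next
    case (insert x A)
    let ?F = "\<lambda>g. \<Prod>x\<in>A. f x (g x)" and ?h = "\<lambda>(y, g). g(x := y)"
    have IH: "?F abs_summable_on PiE A B" "(?F has_sum (\<Prod>x\<in>A. S x)) (PiE A B)"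
      using insert by auto
    have inj: "inj_on ?h (B x \<times> PiE A B)"
      using inj_combinator[OF insert(2), of B] by simp
    have eq: "(\<Prod>z\<in>insert x A. f z (?h u z)) = (\<lambda>(y, g). f x y * ?F g) u" for u
    proof -
      have "(\<Prod>z\<in>A. f z (?h u z)) = (\<Prod>z\<in>A. f z (snd u z))"
        using insert(2) by (intro prod.cong) (auto simp: case_prod_unfold)
      thus ?thesis using insert(1,2) by (simp add: case_prod_unfold)
    qed
    have 1: "(\<lambda>(y, g). f x y * ?F g) abs_summable_on B x \<times> PiE A B"
      by (rule abs_summable_on_Times) (use insert IH in auto)
    have 2: "((\<lambda>(y, g). f x y * ?F g) has_sum S x * (\<Prod>x\<in>A. S x)) (B x \<times> PiE A B)"
      by (rule has_sum_product) (use insert IH in auto)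
    show ?case
      unfolding PiE_insert_eq has_sum_reindex[OF inj] summable_on_reindex[OF inj] o_def eq
      using 1 2 insert(1,2) by simp
  qed
  thus "(\<lambda>g. \<Prod>x\<in>A. f x (g x)) abs_summable_on PiE A B"
    and "((\<lambda>g. \<Prod>x\<in>A. f x (g x)) has_sum (\<Prod>x\<in>A. S x)) (PiE A B)" by auto
qed

section \<open>The divisor function\<close>

lemma divisor_fun_0: "divisor_fun 0 n = (if n = 1 then 1 else 0)"
  using zeta_power_coeffs_unique[OF zeta_power_coeffs_divisor_fun zeta_power_coeffs_0]
  by (simp add: fun_eq_iff)

lemma divisor_fun_Suc:
  "divisor_fun (Suc k) n = (if n = 0 then 0 else \<Sum>m | m dvd n. divisor_fun k m)"
  using zeta_power_coeffs_unique[OF zeta_power_coeffs_divisor_fun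
      zeta_power_coeffs_Suc[OF zeta_power_coeffs_divisor_fun, of k]]
  by (simp add: fun_eq_iff)

lemma divisor_fun_nonneg: "divisor_fun k n \<ge> 0"
  by (induction k arbitrary: n) (auto simp: divisor_fun_0 divisor_fun_Suc intro!: sum_nonneg)

lemma divisor_fun_1: "divisor_fun k (Suc 0) = 1"
  by (induction k) (auto simp: divisor_fun_0 divisor_fun_Suc)

text \<open>\<open>divisor_fun (Suc k)\<close> is the Dirichlet convolution of
  \<open>divisor_fun k\<close> with 1, and every divisor of \<open>m * n\<close> splits uniquely
  into a divisor of \<open>m\<close> and one of \<open>n\<close>.\<close>

lemma divisor_fun_mult_coprime:
  assumes "coprime m n"
  shows "divisor_fun k (m * n) = divisor_fun k m * divisor_fun k n"
  using assms
proof (induction k arbitrary: m n)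
  case 0
  thus ?case by (auto simp: divisor_fun_0)
next
  case (Suc k)
  show ?case
  proof (cases "m = 0 \<or> n = 0")
    case True
    thus ?thesis by (auto simp: divisor_fun_Suc)
  next
    case False
    have inj: "inj_on (\<lambda>(a, b). a * b) ({a. a dvd m} \<times> {b. b dvd n})"
    proof (rule inj_onI, clarify)
      fix a b a' b' assume *: "a dvd m" "b dvd n" "a' dvd m" "b' dvd n" "a * b = a' * b'"
      have "coprime a b'" "coprime a' b" "coprime b a'" "coprime b' a"
        using * Suc.prems by (meson coprime_divisors coprime_commute)+
      hence "a dvd a'" "a' dvd a" "b dvd b'" "b' dvd b"
        using *(5) by (metis coprime_dvd_mult_left_iff coprime_dvd_mult_right_iff dvd_triv_left dvd_triv_right coprime_commute)+
      thus "a = a' \<and> b = b'" by (auto intro: dvd_antisym)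
    qed
    have im: "(\<lambda>(a, b). a * b) ` ({a. a dvd m} \<times> {b. b dvd n}) = {d. d dvd m * n}"
      by (auto simp: image_iff intro: mult_dvd_mono elim!: division_decomp[THEN exE])
    have "divisor_fun (Suc k) (m * n) = (\<Sum>d | d dvd m * n. divisor_fun k d)"
      using False by (simp add: divisor_fun_Suc)
    also have "\<dots> = (\<Sum>(a, b)\<in>{a. a dvd m} \<times> {b. b dvd n}. divisor_fun k (a * b))"
      unfolding im[symmetric] by (subst sum.reindex[OF inj]) (simp add: case_prod_unfold)
    also have "\<dots> = (\<Sum>(a, b)\<in>{a. a dvd m} \<times> {b. b dvd n}. divisor_fun k a * divisor_fun k b)"
    proof (intro sum.cong refl, clarify)
      fix a b assume "a dvd m" "b dvd n"
      hence "coprime a b" using Suc.prems by (meson coprime_divisors)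
      thus "divisor_fun k (a * b) = divisor_fun k a * divisor_fun k b" by (rule Suc.IH)
    qed
    also have "\<dots> = divisor_fun (Suc k) m * divisor_fun (Suc k) n"
      using False by (simp add: divisor_fun_Suc sum_product sum.cartesian_product)
    finally show ?thesis .
  qed
qed

lemma divisor_fun_prime_power_Suc:
  assumes "prime p"
  shows "divisor_fun (Suc k) (p ^ a) = (\<Sum>i\<le>a. divisor_fun k (p ^ i))"
proof -
  have "{m. m dvd p ^ a} = (\<lambda>i. p ^ i) ` {..a}"
    using divides_primepow_nat[OF assms] by auto
  moreover have "inj_on (\<lambda>i. p ^ i) {..a}"
    using prime_gt_1_nat[OF assms] by (auto intro: inj_onI)
  ultimately show ?thesis
    using assms by (simp add: divisor_fun_Suc sum.reindex prime_gt_0_nat)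
qed

text \<open>The local factor of \<open>zeta s ^ k\<close> at \<open>p\<close>. Along the powers of
  \<open>p\<close>, passing from \<open>k\<close> to \<open>Suc k\<close> takes partial sums, which
  is the Cauchy product with a geometric series.\<close>

lemma divisor_fun_gf:
  fixes z :: "'a::{real_normed_field, banach}"
  assumes "prime p" "norm z < 1"
  shows "(\<lambda>a. norm (of_real (divisor_fun k (p ^ a)) * z ^ a)) sums inverse ((1 - norm z) ^ k)"
    and "(\<lambda>a. of_real (divisor_fun k (p ^ a)) * z ^ a) sums inverse ((1 - z) ^ k)"
proof -
  \<comment> \<open>The claim has its own type variable, as it is used both for \<open>z\<close> and
    for the real number \<open>norm z\<close>.\<close>
  have gf: "summable (\<lambda>a. norm (of_real (divisor_fun k (p ^ a)) * w ^ a)) \<and>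
        (\<lambda>a. of_real (divisor_fun k (p ^ a)) * w ^ a) sums inverse ((1 - w) ^ k)"
    if w: "norm w < 1" for w :: "'b::{real_normed_field, banach}"
  proof (induction k)
    case 0
    have eq: "(\<lambda>a. of_real (divisor_fun 0 (p ^ a)) * w ^ a) = (\<lambda>a. if a = 0 then 1 else 0)"
      using prime_gt_1_nat[OF assms(1)] by (auto simp: divisor_fun_0 fun_eq_iff)
    have eq2: "(\<lambda>a. norm (of_real (divisor_fun 0 (p ^ a)) * w ^ a)) = (\<lambda>a. if a = 0 then 1 else 0)"
      using prime_gt_1_nat[OF assms(1)] by (auto simp: divisor_fun_0 fun_eq_iff)
    show ?case unfolding eq2 unfolding eq using sums_single[of 0 "\<lambda>_. 1::'b"] sums_single[of 0 "\<lambda>_. 1::real"]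
      by (auto simp: sums_iff)
  next
    case (Suc k)
    have w': "norm (norm w) < 1" using w by simp
    have conv: "(\<Sum>i\<le>a. (of_real (divisor_fun k (p ^ i)) * v ^ i) * v ^ (a - i)) =
      of_real (divisor_fun (Suc k) (p ^ a)) * v ^ a" for a and v :: "'c::{real_normed_field, banach}"
      by (simp add: divisor_fun_prime_power_Suc[OF assms(1)] sum_distrib_right mult.assoc
          flip: power_add)
    have nn: "norm (of_real (divisor_fun k (p ^ a)) * v ^ a) = of_real (divisor_fun k (p ^ a)) * norm v ^ a"
      for k a and v :: "'c::{real_normed_field, banach}"
      by (simp add: norm_mult norm_power divisor_fun_nonneg)
    have "summable (\<lambda>a. norm (w ^ a))" 
      using w by (simp add: norm_power summable_geometric)
    from Cauchy_product_sums[OF Suc.IH[THEN conjunct1] this]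
    have "(\<lambda>a. of_real (divisor_fun (Suc k) (p ^ a)) * w ^ a) sums
        (inverse ((1 - w) ^ k) * inverse (1 - w))"
      using Suc.IH w by (simp add: conv sums_iff suminf_geometric inverse_eq_divide)
    moreover have "summable (\<lambda>a. \<Sum>i\<le>a. (of_real (divisor_fun k (p ^ i)) * norm w ^ i) * norm w ^ (a - i))"
      using w Suc.IH[THEN conjunct1]
      by (intro summable_Cauchy_product) (auto simp: nn divisor_fun_nonneg summable_geometric)
    hence "summable (\<lambda>a. norm (of_real (divisor_fun (Suc k) (p ^ a)) * w ^ a))"
      unfolding conv nn .
    ultimately show ?case by (simp add: mult.commute)
  qed
  show "(\<lambda>a. of_real (divisor_fun k (p ^ a)) * z ^ a) sums inverse ((1 - z) ^ k)"
    using gf[OF assms(2)] by auto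
  show "(\<lambda>a. norm (of_real (divisor_fun k (p ^ a)) * z ^ a)) sums inverse ((1 - norm z) ^ k)"
    using gf[of "norm z"] assms(2) by (simp add: norm_mult norm_power divisor_fun_nonneg)
qed

text \<open>Splitting off the exact power of \<open>q\<close> is the step by which the Euler product
  of \<open>friable_divisor_sum\<close> gains one prime.\<close>

lemma bij_betw_insert_prime:
  fixes q :: nat
  assumes "prime q" "q \<notin> Q"
  shows "bij_betw (\<lambda>(m, a). m * q ^ a) ({n. n > 0 \<and> prime_factors n \<subseteq> Q} \<times> UNIV)
           {n. n > 0 \<and> prime_factors n \<subseteq> insert q Q}"
proof (rule bij_betwI[where g = "\<lambda>n. (n div q ^ multiplicity q n, multiplicity q n)"])
  have q: "q > 0" "q > 1" using assms(1) prime_gt_0_nat prime_gt_1_nat by auto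
  show "(\<lambda>(m, a). m * q ^ a) \<in> {n. n > 0 \<and> prime_factors n \<subseteq> Q} \<times> UNIV \<rightarrow>
           {n. n > 0 \<and> prime_factors n \<subseteq> insert q Q}"
    using q assms(1)
    by (auto simp: prime_factors_product prime_factorization_prime_power prime_factorization_mult prime_factorization_prime split: if_splits)
  show "(\<lambda>n. (n div q ^ multiplicity q n, multiplicity q n)) \<in> {n. n > 0 \<and> prime_factors n \<subseteq> insert q Q} \<rightarrow>
     {n. n > 0 \<and> prime_factors n \<subseteq> Q} \<times> UNIV"
  proof (rule Pi_I)
    fix n assume "n \<in> {n. n > 0 \<and> prime_factors n \<subseteq> insert q Q}"
    hence n: "0 < n" "prime_factors n \<subseteq> insert q Q" by auto
    define m where "m = n div q ^ multiplicity q n"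
    have nm: "n = m * q ^ multiplicity q n" unfolding m_def by (simp add: multiplicity_dvd)
    have "m > 0" using n nm by (metis gr0I mult_0)
    have "\<not> q dvd m" unfolding m_def using n assms(1)
      by (metis multiplicity_decompose not_prime_unit not_gr_zero)
    have "r \<in> Q" if r: "r \<in> prime_factors m" for r
    proof -
      have "r \<in> prime_factors n"
        using r n(1) nm by (metis dvd_mult2 in_prime_factors_iff not_gr_zero)
      thus ?thesis using n(2) r \<open>\<not> q dvd m\<close> by (auto simp: in_prime_factors_iff)
    qed
    thus "(n div q ^ multiplicity q n, multiplicity q n) \<in> {n. n > 0 \<and> prime_factors n \<subseteq> Q} \<times> UNIV"
      using \<open>m > 0\<close> by (auto simp: m_def)
  qed
  show "(\<lambda>n. (n div q ^ multiplicity q n, multiplicity q n)) ((\<lambda>(m, a). m * q ^ a) x) = x"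
    if "x \<in> {n. n > 0 \<and> prime_factors n \<subseteq> Q} \<times> UNIV" for x
  proof -
    obtain m a where x: "x = (m, a)" by force
    have "\<not> q dvd m" using that assms x by (auto simp: in_prime_factors_iff)
    hence "multiplicity q (m * q ^ a) = a"
      using that assms(1) x q by (subst prime_elem_multiplicity_mult_distrib) 
        (auto simp: not_dvd_imp_multiplicity_0)
    thus ?thesis using q by (simp add: x)
  qed
  show "(\<lambda>(m, a). m * q ^ a) (n div q ^ multiplicity q n, multiplicity q n) = n" for n
    by (simp add: multiplicity_dvd)
qed

section \<open>Fourier coefficients of an Euler factor\<close>

lemma finite_primes_le: "finite {p::nat. prime p \<and> real p \<le> y}"
proof (rule finite_subset)
  show "{p. prime p \<and> real p \<le> y} \<subseteq> {..nat \<lfloor>y\<rfloor>}"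
    by (auto simp: le_nat_floor)
qed auto

text \<open>The coefficient of \<open>w ^ a\<close> in the power series of
  \<open>(1 - w / p) ^ (- k)\<close>.\<close>

definition prime_term :: "nat \<Rightarrow> nat \<Rightarrow> nat \<Rightarrow> real" where
  "prime_term k p a = divisor_fun k (p ^ a) / real p ^ a"

lemma prime_term_nonneg: "prime_term k p a \<ge> 0"
  by (simp add: prime_term_def divisor_fun_nonneg)

lemma prime_term_0: "prime_term k p 0 = 1"
  by (simp add: prime_term_def divisor_fun_1)

lemma prime_term_power_has_sum:
  fixes w :: "'a::{real_normed_field, banach}"
  assumes "prime p" "norm w < p"
  shows "(\<lambda>a. norm (of_real (prime_term k p a) * w ^ a)) summable_on UNIV"
    and "((\<lambda>a. of_real (prime_term k p a) * w ^ a) has_sum inverse ((1 - w / of_nat p) ^ k)) UNIV"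
proof -
  have p: "real p > 0" using assms(1) prime_gt_0_nat by auto
  have "norm (w / of_nat p) < 1" using assms(2) p by (simp add: norm_divide)
  note gf = divisor_fun_gf[OF assms(1) this, of k]
  have eq: "of_real (divisor_fun k (p ^ a)) * (w / of_nat p) ^ a = of_real (prime_term k p a) * w ^ a" for a
    using p by (simp add: prime_term_def power_divide)
  have s: "summable (\<lambda>a. norm (of_real (prime_term k p a) * w ^ a))"
    using gf(1) unfolding eq by (simp add: sums_iff)
  show "(\<lambda>a. norm (of_real (prime_term k p a) * w ^ a)) summable_on UNIV"
    using norm_summable_imp_summable_on[of "\<lambda>a. norm (of_real (prime_term k p a) * w ^ a)"] s by simp
  show "((\<lambda>a. of_real (prime_term k p a) * w ^ a) has_sum inverse ((1 - w / of_nat p) ^ k)) UNIV"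
    using norm_summable_imp_has_sum[OF s] gf(2) unfolding eq by simp
qed

text \<open>The autocorrelation of \<open>prime_term k p\<close>, that is, the coefficient of
  \<open>cis (j * x)\<close> in the Fourier series of the \<open>2 k\<close>-th power of the modulus
  of \<open>1 / (1 - cis (- x) / p)\<close>. For prime \<open>p\<close> the series converges, so no
  default value of the infinite sum enters.\<close>

definition fourier_coeff :: "nat \<Rightarrow> nat \<Rightarrow> int \<Rightarrow> real" where
  "fourier_coeff k p j = (\<Sum>\<^sub>\<infinity>a. prime_term k p a * prime_term k p (a + nat \<bar>j\<bar>))"

lemma prime_term_product_summable:
  assumes "prime p"
  shows "(\<lambda>(a, b). prime_term k p a * prime_term k p b) summable_on UNIV \<times> UNIV"
proof -
  have "(\<lambda>a. norm (prime_term k p a)) summable_on UNIV"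
    using prime_term_power_has_sum(1)[OF assms, of "1::real" k] prime_gt_1_nat[OF assms] by simp
  from abs_summable_on_Times[OF this this] show ?thesis
    by (simp add: case_prod_unfold prime_term_nonneg)
qed

lemma fourier_coeff_has_sum:
  assumes "prime p"
  shows "((\<lambda>a. prime_term k p a * prime_term k p (a + nat \<bar>j\<bar>)) has_sum fourier_coeff k p j) UNIV"
proof -
  have "(\<lambda>(a, b). prime_term k p a * prime_term k p b) summable_on (\<lambda>a. (a, a + nat \<bar>j\<bar>)) ` UNIV"
    by (rule summable_on_subset_banach[OF prime_term_product_summable[OF assms]]) auto
  hence "(\<lambda>a. prime_term k p a * prime_term k p (a + nat \<bar>j\<bar>)) summable_on UNIV"
    by (subst (asm) summable_on_reindex) (auto simp: o_def inj_on_def)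
  thus ?thesis unfolding fourier_coeff_def by (rule has_sum_infsum)
qed

lemma fourier_coeff_nonneg: "fourier_coeff k p j \<ge> 0"
  unfolding fourier_coeff_def by (intro infsum_nonneg) (auto simp: prime_term_nonneg)

lemma fourier_coeff_0_ge_1:
  assumes "prime p"
  shows "fourier_coeff k p 0 \<ge> 1"
proof -
  have "((\<lambda>a. prime_term k p a * prime_term k p (a + nat \<bar>0\<bar>)) has_sum 1) {0}"
    by (rule has_sum_finiteI) (auto simp: prime_term_0)
  thus ?thesis
    by (rule has_sum_mono2[OF _ fourier_coeff_has_sum[OF assms]]) (auto simp: prime_term_nonneg)
qed

lemma fourier_coeff_minus: "fourier_coeff k p (- j) = fourier_coeff k p j"
  by (simp add: fourier_coeff_def)

text \<open>Each product of two terms is at most the mean of their squares, and both series of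
  squares sum to at most the central coefficient.\<close>

lemma fourier_coeff_le_0:
  assumes "prime p"
  shows "fourier_coeff k p j \<le> fourier_coeff k p 0"
proof -
  let ?x = "prime_term k p" and ?m = "nat \<bar>j\<bar>"
  have sq: "((\<lambda>a. (?x a)\<^sup>2) has_sum fourier_coeff k p 0) UNIV"
    using fourier_coeff_has_sum[OF assms, of k 0] by (simp add: power2_eq_square)
  have "(\<lambda>a. (?x a)\<^sup>2) summable_on (\<lambda>a. a + ?m) ` UNIV"
    by (rule summable_on_subset_banach[OF has_sum_imp_summable[OF sq]]) auto
  hence s: "(\<lambda>a. (?x (a + ?m))\<^sup>2) summable_on UNIV"
    by (subst (asm) summable_on_reindex) (auto simp: o_def inj_on_def)
  have "((\<lambda>a. (?x a)\<^sup>2) has_sum (\<Sum>\<^sub>\<infinity>a. (?x (a + ?m))\<^sup>2)) ((\<lambda>a. a + ?m) ` UNIV)"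
    by (subst has_sum_reindex) (use has_sum_infsum[OF s] in \<open>auto simp: o_def\<close>)
  hence le: "(\<Sum>\<^sub>\<infinity>a. (?x (a + ?m))\<^sup>2) \<le> fourier_coeff k p 0"
    by (rule has_sum_mono2[OF _ sq]) auto
  have "((\<lambda>a. ((?x a)\<^sup>2 + (?x (a + ?m))\<^sup>2) * (1/2)) has_sum
          (fourier_coeff k p 0 + (\<Sum>\<^sub>\<infinity>a. (?x (a + ?m))\<^sup>2)) * (1/2)) UNIV"
    by (intro has_sum_cmult_left has_sum_add sq has_sum_infsum[OF s])
  hence "fourier_coeff k p j \<le> (fourier_coeff k p 0 + (\<Sum>\<^sub>\<infinity>a. (?x (a + ?m))\<^sup>2)) * (1/2)"
  proof (rule has_sum_mono[OF fourier_coeff_has_sum[OF assms]])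
    fix a
    show "?x a * ?x (a + ?m) \<le> ((?x a)\<^sup>2 + (?x (a + ?m))\<^sup>2) * (1/2)"
      using sum_squares_bound[of "?x a" "?x (a + ?m)"] by simp
  qed
  with le show ?thesis by simp
qed

text \<open>Groups the double series by the difference \<open>j\<close> of its indices. The pairs
  with difference \<open>j\<close> are \<open>(n + nat (- j), n + nat j)\<close>, where
  \<open>n\<close> is the smaller index.\<close>

lemma fourier_coeff_reindex:
  fixes g :: "int \<Rightarrow> 'a::{real_normed_field, banach}"
  assumes p: "prime p"
  assumes summ: "(\<lambda>(a, b). of_real (prime_term k p a * prime_term k p b) * g (int b - int a))
                   abs_summable_on UNIV \<times> UNIV"
  assumes S: "((\<lambda>(a, b). of_real (prime_term k p a * prime_term k p b) * g (int b - int a))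
                has_sum S) (UNIV \<times> UNIV)"
  shows "(\<lambda>j. norm (of_real (fourier_coeff k p j) * g j)) summable_on UNIV"
    and "((\<lambda>j. of_real (fourier_coeff k p j) * g j) has_sum S) UNIV"
proof -
  let ?x = "prime_term k p"
  \<comment> \<open>Used twice, for \<open>g\<close> and for the real-valued \<open>norm\<close> of
    \<open>g\<close>, hence with its own type variable.\<close>
  have main: "((\<lambda>j. of_real (fourier_coeff k p j) * h j) has_sum S) UNIV"
    if h: "((\<lambda>(a, b). of_real (?x a * ?x b) * h (int b - int a)) has_sum S) (UNIV \<times> UNIV)"
    for h :: "int \<Rightarrow> 'b::{real_normed_field, banach}" and S
  proof -
    have m: "min a b + nat (int a - int b) = a" "min a b + nat (int b - int a) = b" for a b :: nat
      by (auto simp: min_def)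
    have "((\<lambda>(a, b). of_real (?x a * ?x b) * h (int b - int a)) has_sum S) (UNIV \<times> UNIV) \<longleftrightarrow>
      ((\<lambda>(j, n). of_real (?x (n + nat (- j)) * ?x (n + nat j)) * h j) has_sum S) (UNIV \<times> UNIV)"
      by (rule has_sum_reindex_bij_witness[where i = "\<lambda>(j, n). (n + nat (- j), n + nat j)"
            and j = "\<lambda>(a, b). (int b - int a, min a b)"]) (auto simp: m)
    with h have "((\<lambda>(j, n). of_real (?x (n + nat (- j)) * ?x (n + nat j)) * h j) has_sum S) (UNIV \<times> UNIV)"
      by simp
    thus ?thesis
    proof (rule has_sum_SigmaD)
      fix j :: int
      have "?x (n + nat (- j)) * ?x (n + nat j) = ?x n * ?x (n + nat \<bar>j\<bar>)" for n
        by (cases "j \<ge> 0") auto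
      thus "((\<lambda>n. case (j, n) of (j, n) \<Rightarrow> of_real (?x (n + nat (- j)) * ?x (n + nat j)) * h j) has_sum
              of_real (fourier_coeff k p j) * h j) UNIV"
        using fourier_coeff_has_sum[OF p, of k j]
        by (auto intro!: has_sum_cmult_left has_sum_of_real simp flip: of_real_mult)
    qed
  qed
  show "((\<lambda>j. of_real (fourier_coeff k p j) * g j) has_sum S) UNIV"
    by (rule main[OF S])
  have "(\<lambda>(a, b). of_real (?x a * ?x b) * norm (g (int b - int a))) summable_on UNIV \<times> UNIV"
    using summ by (simp add: case_prod_unfold norm_mult prime_term_nonneg)
  from main[OF has_sum_infsum[OF this]] show "(\<lambda>j. norm (of_real (fourier_coeff k p j) * g j)) summable_on UNIV"
    by (auto simp: norm_mult fourier_coeff_nonneg dest: has_sum_imp_summable)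
qed

text \<open>Evaluates the Laurent series of the coefficients at \<open>w\<close>. The condition on
  \<open>g\<close> forces \<open>v * w = 1\<close> and says that \<open>g j\<close> is the
  \<open>j\<close>-th integer power of \<open>w\<close>; it covers points of the unit circle and
  real points \<open>exp b\<close> alike.\<close>

lemma fourier_coeff_laurent:
  fixes w v :: "'a::{real_normed_field, banach}"
  assumes p: "prime p" and "norm w < p" "norm v < p"
  assumes g: "\<And>a b. g (int b - int a) = v ^ a * w ^ b"
  shows "(\<lambda>j. norm (of_real (fourier_coeff k p j) * g j)) summable_on UNIV"
    and "((\<lambda>j. of_real (fourier_coeff k p j) * g j) has_sum
           inverse ((1 - v / of_nat p) ^ k) * inverse ((1 - w / of_nat p) ^ k)) UNIV"
proof -
  note v = prime_term_power_has_sum[OF p assms(3), of k]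
  note w = prime_term_power_has_sum[OF p assms(2), of k]
  have eq: "(\<lambda>(a, b). (of_real (prime_term k p a) * v ^ a) * (of_real (prime_term k p b) * w ^ b)) =
    (\<lambda>(a, b). of_real (prime_term k p a * prime_term k p b) * g (int b - int a))"
    by (simp add: fun_eq_iff g)
  note * = abs_summable_on_Times[OF v(1) w(1), unfolded eq]
    has_sum_product[OF v(1) w(1) v(2) w(2), unfolded eq]
  show "(\<lambda>j. norm (of_real (fourier_coeff k p j) * g j)) summable_on UNIV"
    "((\<lambda>j. of_real (fourier_coeff k p j) * g j) has_sum
           inverse ((1 - v / of_nat p) ^ k) * inverse ((1 - w / of_nat p) ^ k)) UNIV"
    by (fact fourier_coeff_reindex[OF p *])+
qed

text \<open>On the unit circle \<open>v\<close> is the conjugate of \<open>w\<close>, so the two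
  factors combine to a squared modulus.\<close>

lemma fourier_coeff_cis:
  assumes p: "prime p"
  shows "(\<lambda>j. norm (of_real (fourier_coeff k p j) * cis (of_int j * x))) summable_on UNIV"
    and "((\<lambda>j. of_real (fourier_coeff k p j) * cis (of_int j * x)) has_sum
           of_real (norm (inverse (1 - cis (- x) / of_nat p)) ^ (2 * k))) UNIV"
proof -
  have g: "cis (of_int (int b - int a) * x) = cis (- x) ^ a * cis x ^ b" for a b
    unfolding Complex.DeMoivre cis_mult by (rule arg_cong[where f = cis]) (simp add: algebra_simps)
  have 1: "norm (cis (- x)) < real p" "norm (cis x) < real p" using prime_gt_1_nat[OF p] by auto
  have c: "cnj (cis (- x)) = cis x" by (simp add: cis_cnj)
  have "inverse ((1 - cis (- x) / of_nat p) ^ k) * inverse ((1 - cis x / of_nat p) ^ k)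
      = (inverse (1 - cis (- x) / of_nat p) * cnj (inverse (1 - cis (- x) / of_nat p))) ^ k"
    by (simp add: c power_mult_distrib power_inverse)
  also have "\<dots> = of_real (norm (inverse (1 - cis (- x) / of_nat p)) ^ (2 * k))"
    by (simp only: complex_norm_square[symmetric] power_mult of_real_power)
  finally show "((\<lambda>j. of_real (fourier_coeff k p j) * cis (of_int j * x)) has_sum
           of_real (norm (inverse (1 - cis (- x) / of_nat p)) ^ (2 * k))) UNIV"
    using fourier_coeff_laurent(2)[OF p 1(2,1), of "\<lambda>j. cis (of_int j * x)" k] g by simp
  show "(\<lambda>j. norm (of_real (fourier_coeff k p j) * cis (of_int j * x))) summable_on UNIV"
    by (rule fourier_coeff_laurent(1)[OF p 1(2,1)]) (rule g)
qed

text \<open>The quantity that Rankin's trick requires: with \<open>b = a * ln p\<close> the weight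
  becomes \<open>p\<close> raised to \<open>a * \<bar>j\<bar>\<close>.\<close>

definition exp_moment :: "nat \<Rightarrow> nat \<Rightarrow> real \<Rightarrow> real" where
  "exp_moment k p b = (\<Sum>\<^sub>\<infinity>j. fourier_coeff k p j * exp (b * \<bar>of_int j\<bar>))"

lemma exp_moment_nonneg: "exp_moment k p b \<ge> 0"
  unfolding exp_moment_def
  by (intro infsum_nonneg mult_nonneg_nonneg fourier_coeff_nonneg) auto

text \<open>Bounding \<open>\<bar>b' - a\<bar>\<close> by \<open>a + b'\<close> decouples the double
  series into the square of a power series at \<open>exp b\<close>. The loss is of first order in
  \<open>b\<close>, which is affordable for the large primes.\<close>

lemma exp_moment_has_sum:
  assumes p: "prime p" and b: "exp b < p" "b \<ge> 0"
  shows "((\<lambda>j. fourier_coeff k p j * exp (b * \<bar>of_int j\<bar>)) has_sum exp_moment k p b) UNIV"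
    and "exp_moment k p b \<le> inverse ((1 - exp b / p) ^ (2 * k))"
proof -
  let ?x = "prime_term k p"
  have "norm (exp b) < real p" using b by simp
  note e = prime_term_power_has_sum[OF p this, of k]
  note s1 = abs_summable_on_Times[OF e(1) e(1)]
  note s2 = has_sum_product[OF e(1) e(1) e(2) e(2)]
  have le: "(?x a * ?x b') * exp (b * \<bar>of_int (int b' - int a)\<bar>) \<le>
      (?x a * exp b ^ a) * (?x b' * exp b ^ b')" for a b'
  proof -
    have "exp (b * \<bar>of_int (int b' - int a)\<bar>) \<le> exp (b * (real a + real b'))"
      using b by (auto intro!: mult_left_mono)
    also have "\<dots> = exp b ^ a * exp b ^ b'"
      by (simp add: exp_add distrib_left exp_of_nat_mult mult.commute[of b])
    finally have "(?x a * ?x b') * exp (b * \<bar>of_int (int b' - int a)\<bar>) \<le> (?x a * ?x b') * (exp b ^ a * exp b ^ b')"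
      by (intro mult_left_mono) (auto simp: prime_term_nonneg)
    thus ?thesis by (simp add: mult_ac)
  qed
  let ?f = "\<lambda>(a, b'). of_real (?x a * ?x b') * exp (b * \<bar>of_int (int b' - int a)\<bar>) :: real"
  have abs: "(\<lambda>u. norm (?f u)) summable_on UNIV \<times> UNIV"
    by (rule Infinite_Sum.abs_summable_on_comparison_test[OF s1])
       (use le in \<open>auto simp: prime_term_nonneg abs_mult\<close>)
  hence hs: "(?f has_sum infsum ?f (UNIV \<times> UNIV)) (UNIV \<times> UNIV)"
    by (rule has_sum_infsum[OF abs_summable_summable])
  note r = fourier_coeff_reindex[OF p, of k "\<lambda>j. exp (b * \<bar>of_int j\<bar>)", OF abs hs]
  show 1: "((\<lambda>j. fourier_coeff k p j * exp (b * \<bar>of_int j\<bar>)) has_sum exp_moment k p b) UNIV"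
    unfolding exp_moment_def using r(2) by (simp add: has_sum_infsum has_sum_imp_summable)
  have "exp_moment k p b = infsum ?f (UNIV \<times> UNIV)"
    using has_sum_unique[OF 1] r(2) by simp
  also have "\<dots> \<le> inverse ((1 - exp b / of_nat p) ^ k) * inverse ((1 - exp b / of_nat p) ^ k)"
    by (rule has_sum_mono[OF hs s2]) (use le in auto)
  also have "\<dots> = inverse ((1 - exp b / p) ^ (2 * k))"
    by (simp add: mult_2 power_add)
  finally show "exp_moment k p b \<le> inverse ((1 - exp b / p) ^ (2 * k))" .
qed

text \<open>\<open>exp (b * \<bar>j\<bar>)\<close> is at most
  \<open>exp (b * j) + exp (- b * j)\<close>, and by symmetry both give the same Laurent value. In
  that value the terms of first order in \<open>b\<close> cancel, which is what the small primes
  require.\<close>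

lemma exp_moment_le_laurent:
  assumes p: "prime p" and b: "exp b < p" "b \<ge> 0"
  shows "exp_moment k p b \<le> 2 * (inverse ((1 - exp (- b) / p) ^ k) * inverse ((1 - exp b / p) ^ k))"
proof -
  let ?F = "inverse ((1 - exp (- b) / p) ^ k) * inverse ((1 - exp b / p) ^ k)"
  have g: "exp (b * of_int (int c - int a)) = exp (- b) ^ a * exp b ^ c" for a c
    by (simp add: exp_of_nat_mult[symmetric] algebra_simps flip: exp_add)
  have "exp (- b) \<le> exp b" using b by simp
  from le_less_trans[OF this b(1)] have n: "norm (exp (- b)) < real p" "norm (exp b) < real p"
    using b by simp_all
  have 1: "((\<lambda>j. fourier_coeff k p j * exp (b * of_int j)) has_sum ?F) UNIV"
    using fourier_coeff_laurent(2)[OF p n(2,1), of "\<lambda>j. exp (b * of_int j)" k] g by simp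
  have "((\<lambda>j. fourier_coeff k p j * exp (b * of_int j)) has_sum ?F) UNIV \<longleftrightarrow>
        ((\<lambda>j. fourier_coeff k p j * exp (- b * of_int j)) has_sum ?F) UNIV"
    by (rule has_sum_reindex_bij_witness[where i = uminus and j = uminus]) (auto simp: fourier_coeff_minus)
  with 1 have 2: "((\<lambda>j. fourier_coeff k p j * exp (- b * of_int j)) has_sum ?F) UNIV" by simp
  have "((\<lambda>j. fourier_coeff k p j * exp (b * of_int j) + fourier_coeff k p j * exp (- b * of_int j)) has_sum ?F + ?F) UNIV"
    by (intro has_sum_add 1 2)
  hence "exp_moment k p b \<le> ?F + ?F"
  proof (rule has_sum_mono[OF exp_moment_has_sum(1)[OF assms]])
    fix j :: int
    have "exp (b * \<bar>of_int j\<bar>) \<le> exp (b * of_int j) + exp (- b * of_int j)"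
      by (cases "j \<ge> 0") auto
    thus "fourier_coeff k p j * exp (b * \<bar>of_int j\<bar>) \<le> 
      fourier_coeff k p j * exp (b * of_int j) + fourier_coeff k p j * exp (- b * of_int j)"
      using mult_left_mono[OF _ fourier_coeff_nonneg] by (simp flip: distrib_left)
  qed
  thus ?thesis unfolding mult_2 .
qed

section \<open>The Euler product of the friable divisor sum\<close>

lemma friable_divisor_sum_eq:
  "friable_divisor_sum k y = (\<Prod>p | prime p \<and> real p \<le> y. fourier_coeff k p 0)"
proof -
  define g where "g = (\<lambda>n. (divisor_fun k n)\<^sup>2 / (real n)\<^sup>2)"
  have "(g has_sum (\<Prod>p\<in>Q. fourier_coeff k p 0)) {n. n > 0 \<and> prime_factors n \<subseteq> Q}"
    if "finite Q" "\<And>q. q \<in> Q \<Longrightarrow> prime q" for Q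
    using that
  proof (induction Q rule: finite_induct)
    case empty
    have "{n::nat. n > 0 \<and> prime_factors n \<subseteq> {}} = {1}"
      by (auto simp: prime_factorization_empty_iff)
    moreover have "(g has_sum 1) {1}"
      by (rule has_sum_finiteI) (simp_all add: g_def divisor_fun_1)
    ultimately show ?case by simp
  next
    case (insert q Q)
    have q: "prime q" using insert by auto
    have sq: "((\<lambda>a. (prime_term k q a)\<^sup>2) has_sum fourier_coeff k q 0) UNIV"
      using fourier_coeff_has_sum[OF q, of k 0] by (simp add: power2_eq_square)
    let ?A = "{n. n > 0 \<and> prime_factors n \<subseteq> Q}"
    have IH: "(g has_sum (\<Prod>p\<in>Q. fourier_coeff k p 0)) ?A" using insert by auto
    have "((\<lambda>(m, a). g m * (prime_term k q a)\<^sup>2) has_sum (\<Prod>p\<in>Q. fourier_coeff k p 0) * fourier_coeff k q 0) (?A \<times> UNIV)"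
      using IH sq by (intro has_sum_product)
        (auto simp: g_def abs_mult has_sum_imp_summable intro: has_sum_imp_summable)
    moreover have "((\<lambda>(m, a). g m * (prime_term k q a)\<^sup>2) has_sum S) (?A \<times> UNIV) \<longleftrightarrow>
      ((\<lambda>u. g ((\<lambda>(m, a). m * q ^ a) u)) has_sum S) (?A \<times> UNIV)" for S
    proof (rule has_sum_cong)
      fix u assume "u \<in> ?A \<times> (UNIV :: nat set)"
      then obtain m a where u: "u = (m, a)" "m \<in> ?A" by blast
      hence "\<not> q dvd m" using q insert(2) by (auto simp: in_prime_factors_iff)
      hence "coprime m (q ^ a)"
        using prime_imp_coprime[OF q, of m] by (simp add: coprime_commute)
      thus "(case u of (m, a) \<Rightarrow> g m * (prime_term k q a)\<^sup>2) = g ((\<lambda>(m, a). m * q ^ a) u)"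
        by (simp add: u g_def prime_term_def divisor_fun_mult_coprime power_mult_distrib power_divide)
    qed
    ultimately have "((\<lambda>u. g ((\<lambda>(m, a). m * q ^ a) u)) has_sum (\<Prod>p\<in>Q. fourier_coeff k p 0) * fourier_coeff k q 0) (?A \<times> UNIV)"
      by simp
    hence "(g has_sum (\<Prod>p\<in>Q. fourier_coeff k p 0) * fourier_coeff k q 0) {n. n > 0 \<and> prime_factors n \<subseteq> insert q Q}"
      unfolding has_sum_reindex_bij_betw[OF bij_betw_insert_prime[OF q insert(2)], of g] .
    thus ?case using insert(1,2) by (simp add: mult.commute)
  qed
  from this[OF finite_primes_le[of y]]
  have "(g has_sum (\<Prod>p | prime p \<and> real p \<le> y. fourier_coeff k p 0))
    {n. n > 0 \<and> prime_factors n \<subseteq> {p. prime p \<and> real p \<le> y}}" by simp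
  moreover have "{n. n > 0 \<and> prime_factors n \<subseteq> {p. prime p \<and> real p \<le> y}} = friable y"
    by (auto simp: friable_def in_prime_factors_iff)
  ultimately show ?thesis
    unfolding friable_divisor_sum_def by (simp add: g_def infsumI)
qed

section \<open>Exponential moments of the coefficients\<close>

text \<open>With \<open>z = exp b / p\<close>, the bound
  \<open>1 / (1 - z) \<le> 1 + 5 / 2 * z\<close> holds up to \<open>z = 3 / 5\<close>, where it is
  an equality. The central coefficient enters only through being at least 1.\<close>

lemma exp_moment_le_large:
  assumes p: "prime p" and b: "b \<ge> 0" "exp b / p \<le> 3 / 5"
  shows "exp_moment k p b \<le> fourier_coeff k p 0 * exp (5 * real k * exp b / p)"
proof -
  have p0: "real p > 0" using p prime_gt_0_nat by auto
  define z where "z = exp b / p"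
  have z: "z \<ge> 0" "z \<le> 3 / 5" using b by (auto simp: z_def)
  have "exp b < p" using z(2) p0 by (simp add: z_def field_simps)
  note exp_moment_has_sum(2)[OF p this b(1), of k]
  also have "inverse ((1 - exp b / p) ^ (2 * k)) = inverse (1 - z) ^ (2 * k)"
    by (simp add: z_def power_inverse)
  also have "inverse (1 - z) \<le> 1 + 5 / 2 * z"
  proof -
    have "1 \<le> (1 + 5 / 2 * z) * (1 - z)"
      using mult_nonneg_nonneg[of z "3 / 5 - z"] z by (simp add: algebra_simps)
    thus ?thesis using z by (simp add: field_simps)
  qed
  hence "inverse (1 - z) \<le> exp (5 / 2 * z)" using exp_ge_add_one_self order_trans by blast
  hence "inverse (1 - z) ^ (2 * k) \<le> exp (5 / 2 * z) ^ (2 * k)"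
    using z by (intro power_mono) auto
  also have "\<dots> = 1 * exp (5 * real k * exp b / p)"
    by (simp add: z_def flip: exp_of_nat_mult)
  also have "\<dots> \<le> fourier_coeff k p 0 * exp (5 * real k * exp b / p)"
    by (rule mult_right_mono[OF fourier_coeff_0_ge_1[OF p]]) auto
  finally show ?thesis .
qed

text \<open>The product of the two bases is \<open>q - u\<close> with \<open>u\<close> of second
  order in \<open>b\<close>. Since \<open>q \<ge> 1 / 4\<close>, \<open>u\<close> is at most
  \<open>r * q\<close> with \<open>r = 8 * b ^ 2 / p\<close>, and
  \<open>1 / (1 - r) \<le> exp (3 / 2 * r)\<close> produces the constant 12.\<close>

lemma laurent_value_le:
  fixes p :: real
  assumes p: "p \<ge> 2" and b: "0 \<le> b" "b \<le> 1 / 4"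
  shows "inverse ((1 - exp (- b) / p) ^ k) * inverse ((1 - exp b / p) ^ k)
           \<le> inverse ((1 - 1 / p) ^ (2 * k)) * exp (12 * real k * b\<^sup>2 / p)"
proof -
  define q where "q = (1 - 1 / p)\<^sup>2"
  have "(1/2)\<^sup>2 \<le> (1 - 1 / p)\<^sup>2" by (rule power_mono) (use p in \<open>auto simp: field_simps\<close>)
  hence q: "q \<ge> 1 / 4" by (simp add: q_def power2_eq_square)
  define u where "u = (exp b + exp (- b) - 2) / p"
  have "exp b \<le> 1 + b + b\<^sup>2" using b by (intro exp_bound) auto
  moreover have "exp (- b) \<le> 1 - b + b\<^sup>2"
  proof -
    have "1 \<le> (1 - b + b\<^sup>2) * (1 + b)"
      using b by (simp add: algebra_simps power2_eq_square)
    also have "\<dots> \<le> (1 - b + b\<^sup>2) * exp b"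
      using b by (intro mult_left_mono) (auto intro: add_nonneg_nonneg)
    finally show ?thesis by (simp add: exp_minus field_simps)
  qed
  ultimately have u: "u \<le> 2 * b\<^sup>2 / p" using p by (simp add: u_def divide_right_mono)
  have "b\<^sup>2 \<le> (1/4)\<^sup>2" using b by (intro power_mono) auto
  hence b2: "b\<^sup>2 \<le> 1 / 16" by (simp add: power2_eq_square)
  define r where "r = 8 * b\<^sup>2 / p"
  have r: "0 \<le> r" "r \<le> 1 / 4"
    using p b2 by (auto simp: r_def field_simps)
  have "u \<le> r * (1 / 4)" using u by (simp add: r_def)
  also have "\<dots> \<le> r * q" using q r by (intro mult_left_mono) auto
  finally have ur: "u \<le> r * q" .
  have "(1 - exp (- b) / p) * (1 - exp b / p) = q - u"
    using p by (simp add: q_def u_def field_simps power2_eq_square flip: exp_add)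
  also have "q - u \<ge> q * (1 - r)" using ur by (simp add: algebra_simps)
  finally have low: "(1 - exp (- b) / p) * (1 - exp b / p) \<ge> q * (1 - r)" .
  have pos: "q * (1 - r) > 0" using q r by auto
  have "inverse (1 - r) \<le> 1 + 3 / 2 * r"
  proof -
    have "1 \<le> (1 + 3 / 2 * r) * (1 - r)"
      using mult_nonneg_nonneg[of r "1 / 4 - r"] r by (simp add: algebra_simps)
    thus ?thesis using r by (simp add: field_simps)
  qed
  hence er: "inverse (1 - r) \<le> exp (3 / 2 * r)" using exp_ge_add_one_self order_trans by blast
  have "inverse ((1 - exp (- b) / p) * (1 - exp b / p)) \<le> inverse (q * (1 - r))"
    using low pos by (rule le_imp_inverse_le)
  also have "\<dots> \<le> inverse q * exp (3 / 2 * r)"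
    using er q by (auto intro!: mult_left_mono)
  finally have "inverse ((1 - exp (- b) / p) * (1 - exp b / p)) ^ k \<le> (inverse q * exp (3 / 2 * r)) ^ k"
    using low pos by (intro power_mono less_imp_le[OF positive_imp_inverse_positive]) linarith+
  also have "\<dots> = inverse ((1 - 1 / p) ^ (2 * k)) * exp (12 * real k * b\<^sup>2 / p)"
    by (simp add: q_def r_def power_mult_distrib power_inverse power_mult flip: exp_of_nat_mult)
  also have "inverse ((1 - exp (- b) / p) * (1 - exp b / p)) ^ k =
    inverse ((1 - exp (- b) / p) ^ k) * inverse ((1 - exp b / p) ^ k)"
    by (simp add: power_inverse power_mult_distrib)
  finally show ?thesis .
qed

text \<open>The moment at \<open>b = sqrt (p / k) / 4\<close> shows that half of the mass of the Fourier
  coefficients lies on \<open>\<bar>j\<bar> \<le> J\<close> with \<open>J\<close> of order \<open>sqrt (k / p)\<close>, where each of them is at most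
  the central one.\<close>
lemma total_mass_le_central:
  assumes p: "prime p" and pk: "p \<le> k"
  shows "inverse ((1 - 1 / p) ^ (2 * k)) \<le> 54 * (real k / p) * fourier_coeff k p 0"
proof -
  have p2: "real p \<ge> 2" using prime_ge_2_nat[OF p] by simp
  have k0: "real k > 0" using p2 pk by simp
  define s where "s = sqrt (real k / p)"
  have s: "s \<ge> 1" "s * s = k / p" using p2 pk by (auto simp: s_def)
  define b where "b = 1 / (4 * s)"
  have b: "0 < b" "b \<le> 1 / 4" using s by (auto simp: b_def field_simps)
  have "b\<^sup>2 = 1 / (16 * (s * s))" by (simp add: b_def power2_eq_square)
  also have "\<dots> = p / (16 * k)" using p2 k0 by (simp add: s(2))
  finally have bk: "12 * real k * b\<^sup>2 / p = 3 / 4" using p2 k0 by simp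
  have "exp b \<le> 1 + b + b\<^sup>2" using b by (intro exp_bound) auto
  also have "b\<^sup>2 \<le> b * 1" unfolding power2_eq_square using b by (intro mult_left_mono) auto
  finally have eb: "exp b < p" using b p2 by simp
  let ?F = "inverse ((1 - 1 / p) ^ (2 * k))" and ?c = "fourier_coeff k p"
  have M: "exp_moment k p b \<le> 2 * (?F * exp (3 / 4))"
    using exp_moment_le_laurent[OF p eb, of k] laurent_value_le[OF p2, of b k] b unfolding bk by simp
  \<comment> \<open>Beyond \<open>12 * s\<close> the exponent \<open>b * \<bar>j\<bar>\<close> is at
    least 3, so the tail is at most \<open>exp (- 3)\<close> times the moment.\<close>
  define J where "J = nat \<lceil>12 * s\<rceil>"
  have J: "12 * s \<le> J" "J \<le> 12 * s + 1" using s by (auto simp: J_def; linarith)+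
  have F: "(?c has_sum ?F) UNIV"
  proof -
    have "norm (1::real) < p" using p2 by simp
    from fourier_coeff_laurent(2)[OF p this this, of "\<lambda>_. 1" k] show ?thesis
      by (simp add: mult_2 power_add)
  qed
  have "((\<lambda>j. if j \<in> {- int J..int J} then ?c 0 else 0) has_sum (2 * real J + 1) * ?c 0) UNIV"
  proof -
    have "((\<lambda>_. ?c 0) has_sum (2 * real J + 1) * ?c 0) {- int J..int J}"
      by (rule has_sum_finiteI) (auto simp: algebra_simps)
    thus ?thesis by (subst (asm) has_sum_cong_neutral[where T = UNIV and g = "\<lambda>j. if j \<in> {- int J..int J} then ?c 0 else 0"]) auto
  qed
  hence "((\<lambda>j. (if j \<in> {- int J..int J} then ?c 0 else 0) + exp (- 3) * (?c j * exp (b * \<bar>of_int j\<bar>))) has_sum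
          (2 * real J + 1) * ?c 0 + exp (- 3) * exp_moment k p b) UNIV"
    using b by (intro has_sum_add has_sum_cmult_right exp_moment_has_sum(1)[OF p eb]) auto
  hence "?F \<le> (2 * real J + 1) * ?c 0 + exp (- 3) * exp_moment k p b"
  proof (rule has_sum_mono[OF F])
    fix j :: int
    show "?c j \<le> (if j \<in> {- int J..int J} then ?c 0 else 0) + exp (- 3) * (?c j * exp (b * \<bar>of_int j\<bar>))"
    proof (cases "j \<in> {- int J..int J}")
      case True
      thus ?thesis using fourier_coeff_le_0[OF p, of k j] fourier_coeff_nonneg[of k p j]
        by (simp add: add_increasing2)
    next
      case False
      have "\<bar>real_of_int j\<bar> \<ge> J" using False by auto
      hence "3 \<le> b * \<bar>of_int j\<bar>" using J(1) b s by (simp add: b_def field_simps)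
      hence "1 \<le> exp (- 3) * exp (b * \<bar>of_int j\<bar>)" by (simp flip: exp_add)
      from mult_left_mono[OF this fourier_coeff_nonneg[of k p j]]
      have "?c j \<le> exp (- 3) * (?c j * exp (b * \<bar>of_int j\<bar>))" by (simp add: mult_ac)
      thus ?thesis using False by (simp only: if_False)
    qed
  qed
  also have "exp (- 3) * exp_moment k p b \<le> exp (- 3) * (2 * (?F * exp (3 / 4)))"
    by (rule mult_left_mono[OF M]) auto
  \<comment> \<open>The tail amounts to at most half of the total mass \<open>?F\<close> and is
    absorbed into the left-hand side.\<close>
  also have "\<dots> = ?F * 2 * exp (- 9 / 4)" by (simp add: mult_ac flip: exp_add)
  also have "\<dots> \<le> ?F * 2 * (1 / 4)"
  proof (rule mult_left_mono)
    have "4 \<le> exp (9 / 4 :: real)"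
      using exp_lower_Taylor_quadratic[of "9 / 4 :: real"] by (simp add: power2_eq_square)
    thus "exp (- 9 / 4) \<le> (1 / 4 :: real)"
      by (simp add: exp_minus field_simps)
  qed (use p2 in auto)
  finally have "?F \<le> 2 * (2 * real J + 1) * ?c 0" unfolding mult.assoc by linarith
  \<comment> \<open>Replacing \<open>s\<close> by its square removes the root. The loss is harmless,
    because only the logarithm of this factor matters later.\<close>
  also have "\<dots> \<le> 54 * (s * s) * ?c 0"
  proof (rule mult_right_mono[OF _ fourier_coeff_nonneg])
    have "s \<le> s * s" using s(1) by simp
    hence "54 * s \<le> 54 * (s * s)" by (rule mult_left_mono) simp
    moreover have "2 * (2 * real J + 1) \<le> 54 * s" using J(2) s(1) by simp
    ultimately show "2 * (2 * real J + 1) \<le> 54 * (s * s)" by (rule order_trans[rotated])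
  qed
  finally show ?thesis by (simp add: s(2))
qed

text \<open>The Laurent value is the total mass times a Gaussian factor; the total mass in turn
  exceeds the central coefficient by at most a factor of order \<open>k / p\<close>.\<close>

lemma exp_moment_le_small:
  assumes p: "prime p" and pk: "p \<le> k" and b: "0 \<le> b" "b \<le> 1 / 4"
  shows "exp_moment k p b \<le> fourier_coeff k p 0 * (108 * (real k / p) * exp (12 * real k * b\<^sup>2 / p))"
proof -
  have p2: "real p \<ge> 2" using prime_ge_2_nat[OF p] by simp
  have "exp b \<le> 1 + b + b\<^sup>2" using b by (intro exp_bound) auto
  also have "b\<^sup>2 \<le> b * 1" unfolding power2_eq_square using b by (intro mult_left_mono) auto
  finally have eb: "exp b < p" using b p2 by simp
  have "exp_moment k p b \<le> 2 * (inverse ((1 - 1 / p) ^ (2 * k)) * exp (12 * real k * b\<^sup>2 / p))"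
    using exp_moment_le_laurent[OF p eb b(1), of k] laurent_value_le[OF p2 b, of k] by simp
  also have "\<dots> \<le> 2 * (54 * (real k / p) * fourier_coeff k p 0 * exp (12 * real k * b\<^sup>2 / p))"
    by (intro mult_left_mono mult_right_mono total_mass_le_central assms) auto
  finally show ?thesis by (simp add: mult_ac)
qed

section \<open>Chebyshev's bound for primes in dyadic intervals\<close>

lemma prod_primes_dvd:
  fixes N :: nat
  assumes "finite B" "\<And>p. p \<in> B \<Longrightarrow> prime p \<and> p dvd N"
  shows "\<Prod>B dvd N"
  using assms
proof (induction B rule: finite_induct)
  case (insert q B)
  have "coprime q (\<Prod>B)"
    using insert by (intro prod_coprime_right) (auto intro: primes_coprime)
  thus ?case using insert by (auto intro: divides_mult)
qed auto

text \<open>The primes in \<open>(n, 2 n]\<close> all divide the central binomial coefficient, which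
  is at most \<open>4 ^ n\<close>; hence \<open>n ^ card B \<le> 4 ^ n\<close>. The factor
  \<open>i + 1\<close> in place of \<open>i\<close> keeps the bound meaningful at
  \<open>i = 0\<close>.\<close>

lemma card_primes_dyadic:
  "real (i + 1) * card {p::nat. prime p \<and> 2 ^ i < p \<and> p \<le> 2 ^ (i + 1)} \<le> 4 * 2 ^ i"
proof -
  define n :: nat where "n = 2 ^ i"
  define B where "B = {p. prime p \<and> n < p \<and> p \<le> 2 * n}"
  have fin: "finite B" by (rule finite_subset[of _ "{..2 * n}"]) (auto simp: B_def)
  have "\<Prod>B dvd (2 * n) choose n"
  proof (rule prod_primes_dvd[OF fin], intro conjI)
    fix p assume p: "p \<in> B"
    thus pp: "prime p" by (simp add: B_def)
    have "p dvd fact (2 * n)" using p by (simp add: B_def prime_dvd_fact_iff)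
    also have "fact (2 * n) = (fact n * fact n * ((2 * n) choose n) :: nat)"
      using binomial_fact_lemma[of n "2 * n"] by (simp add: mult_2)
    finally show "p dvd (2 * n) choose n"
      using p pp by (simp add: B_def prime_dvd_mult_iff prime_dvd_fact_iff)
  qed
  hence "\<Prod>B \<le> (2 * n) choose n" by (rule dvd_imp_le) simp
  also have "\<dots> \<le> 2 ^ (2 * n)" by (rule binomial_le_pow2)
  finally have up: "\<Prod>B \<le> 2 ^ (2 * n)" .
  have "n ^ card B = (\<Prod>p\<in>B. n)" by simp
  also have "\<dots> \<le> \<Prod>B" by (rule prod_mono) (auto simp: B_def)
  finally have "n ^ card B \<le> 2 ^ (2 * n)" using up by linarith
  hence "(2::nat) ^ (i * card B) \<le> 2 ^ (2 * n)" by (simp add: n_def power_mult)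
  hence 1: "i * card B \<le> 2 * n" by simp
  have "card B \<le> card {n<..2 * n}" by (rule card_mono) (auto simp: B_def)
  hence 2: "card B \<le> n" by simp
  have "(i + 1) * card B \<le> 4 * n"
  proof (cases "i = 0")
    case False
    hence "card B \<le> i * card B" by simp
    thus ?thesis using 1 unfolding add_mult_distrib mult_1 by linarith
  qed (use 2 in auto)
  hence "real ((i + 1) * card B) \<le> real (4 * n)" by (rule of_nat_mono)
  thus ?thesis by (simp add: B_def n_def algebra_simps)
qed

section \<open>Truncated blocks\<close>

text \<open>For primes, the logarithm of the rational number with exponent \<open>j p\<close> at
  \<open>p\<close>; \<open>height\<close> below is the logarithm of its numerator times its
  denominator.\<close>

definition freq :: "nat set \<Rightarrow> (nat \<Rightarrow> int) \<Rightarrow> real" where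
  "freq B j = (\<Sum>p\<in>B. of_int (j p) * ln (real p))"

definition height :: "nat set \<Rightarrow> (nat \<Rightarrow> int) \<Rightarrow> real" where
  "height B j = (\<Sum>p\<in>B. \<bar>of_int (j p)\<bar> * ln (real p))"

definition block_coeff :: "nat \<Rightarrow> nat set \<Rightarrow> (nat \<Rightarrow> int) \<Rightarrow> real" where
  "block_coeff k B j = (\<Prod>p\<in>B. fourier_coeff k p (j p))"

text \<open>The functions are extensional on \<open>B\<close>, which makes this index set finite for
  a finite set of primes.\<close>

definition exponents :: "nat set \<Rightarrow> real \<Rightarrow> (nat \<Rightarrow> int) set" where
  "exponents B W = {j \<in> B \<rightarrow>\<^sub>E UNIV. height B j \<le> W}"

text \<open>Here \<open>cis (- (t * ln p)) / p\<close> is \<open>p powr (- 1 - \<i> * t)\<close>, so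
  this is the \<open>2 k\<close>-th power of the modulus of a partial Euler product on the line
  \<open>Re s = 1\<close>.\<close>

definition euler_block :: "nat \<Rightarrow> nat set \<Rightarrow> real \<Rightarrow> real" where
  "euler_block k B t = (\<Prod>p\<in>B. norm (inverse (1 - cis (- (t * ln (real p))) / of_nat p)) ^ (2 * k))"

text \<open>Cosines suffice, because the coefficients are even and the truncation is symmetric under
  \<open>j \<mapsto> - j\<close>.\<close>

definition block_poly :: "nat \<Rightarrow> nat set \<Rightarrow> real \<Rightarrow> real \<Rightarrow> real" where
  "block_poly k B W t = (\<Sum>j\<in>exponents B W. block_coeff k B j * cos (t * freq B j))"

lemma block_coeff_nonneg: "block_coeff k B j \<ge> 0"
  unfolding block_coeff_def by (intro prod_nonneg ballI fourier_coeff_nonneg)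

lemma cis_sum: "cis (\<Sum>i\<in>I. f i) = (\<Prod>i\<in>I. cis (f i))"
  by (induction I rule: infinite_finite_induct) (auto simp flip: cis_mult)

lemma finite_exponents:
  assumes "finite B" "\<And>p. p \<in> B \<Longrightarrow> prime p"
  shows "finite (exponents B W)"
proof (rule finite_subset)
  define n where "n = \<lceil>W / ln 2\<rceil>"
  show "exponents B W \<subseteq> (B \<rightarrow>\<^sub>E {- n..n})"
  proof (rule subsetI, rule PiE_I)
    fix j p assume j: "j \<in> exponents B W" and p: "p \<in> B"
    have p2: "real p \<ge> 2" using prime_ge_2_nat[OF assms(2)[OF p]] by simp
    have "\<bar>of_int (j p)\<bar> * ln 2 \<le> \<bar>of_int (j p)\<bar> * ln (real p)"
      using p2 by (intro mult_left_mono) auto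
    also have "\<dots> \<le> height B j"
      unfolding height_def
      by (rule member_le_sum) (use p assms prime_ge_1_nat in \<open>force intro: mult_nonneg_nonneg\<close>)+
    also have "\<dots> \<le> W" using j by (simp add: exponents_def)
    finally have "\<bar>of_int (j p)\<bar> \<le> W / ln 2" by (simp add: field_simps)
    hence "real_of_int \<bar>j p\<bar> \<le> of_int n" unfolding n_def by linarith
    hence "\<bar>j p\<bar> \<le> n" by (simp only: of_int_le_iff)
    thus "j p \<in> {- n..n}" by auto
  next
    fix j p assume "j \<in> exponents B W" "p \<notin> B"
    thus "j p = undefined" by (auto simp: exponents_def PiE_def extensional_def)
  qed
  show "finite (B \<rightarrow>\<^sub>E {- n..n})" using assms by (intro finite_PiE) auto
qed

text \<open>\<open>height\<close> is additive over the primes, so the moment of a block factors. The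
  condition \<open>a < 1\<close> keeps \<open>exp (a * ln p)\<close> below \<open>p\<close>, inside
  the domain of convergence.\<close>

lemma block_coeff_exp_has_sum:
  assumes B: "finite B" "\<And>p. p \<in> B \<Longrightarrow> prime p" and a: "0 \<le> a" "a < 1"
  shows "((\<lambda>j. block_coeff k B j * exp (a * height B j)) has_sum
           (\<Prod>p\<in>B. exp_moment k p (a * ln p))) (B \<rightarrow>\<^sub>E UNIV)"
proof -
  have hs: "((\<lambda>j. fourier_coeff k p j * exp (a * ln p * \<bar>of_int j\<bar>)) has_sum exp_moment k p (a * ln p)) UNIV"
    if "p \<in> B" for p
  proof (rule exp_moment_has_sum(1)[OF B(2)[OF that]])
    have p: "real p > 1" using prime_gt_1_nat[OF B(2)[OF that]] by simp
    hence "exp (a * ln p) < exp (1 * ln p)" unfolding exp_less_cancel_iff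
      using a by (intro mult_strict_right_mono) auto
    thus "exp (a * ln p) < p" using p by simp
    show "a * ln p \<ge> 0" using p a by simp
  qed
  have eq: "(\<Prod>p\<in>B. fourier_coeff k p (j p) * exp (a * ln p * \<bar>of_int (j p)\<bar>))
      = block_coeff k B j * exp (a * height B j)" for j
    using B(1) by (simp add: block_coeff_def height_def prod.distrib sum_distrib_left exp_sum mult_ac)
  show ?thesis
    unfolding eq[symmetric]
    by (rule has_sum_prod_PiE(2)[OF B(1) _ hs])
       (use hs in \<open>auto simp: abs_mult fourier_coeff_nonneg dest: has_sum_imp_summable\<close>)
qed

lemma euler_block_has_sum:
  assumes B: "finite B" "\<And>p. p \<in> B \<Longrightarrow> prime p"
  shows "((\<lambda>j. block_coeff k B j * cos (t * freq B j)) has_sum euler_block k B t) (B \<rightarrow>\<^sub>E UNIV)"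
proof -
  let ?f = "\<lambda>p j. of_real (fourier_coeff k p j) * cis (of_int j * (t * ln (real p)))"
  have "((\<lambda>j. \<Prod>p\<in>B. ?f p (j p)) has_sum
     (\<Prod>p\<in>B. of_real (norm (inverse (1 - cis (- (t * ln (real p))) / of_nat p)) ^ (2 * k)))) (B \<rightarrow>\<^sub>E UNIV)"
    by (rule has_sum_prod_PiE(2)[OF B(1)]) (use fourier_coeff_cis[OF B(2)] in auto)
  also have "(\<lambda>j. \<Prod>p\<in>B. ?f p (j p)) = (\<lambda>j. of_real (block_coeff k B j) * cis (t * freq B j))"
    by (simp add: fun_eq_iff prod.distrib block_coeff_def freq_def sum_distrib_left flip: cis_sum)
       (simp add: mult_ac)
  also have "(\<Prod>p\<in>B. of_real (norm (inverse (1 - cis (- (t * ln (real p))) / of_nat p)) ^ (2 * k)))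
     = complex_of_real (euler_block k B t)"
    by (simp add: euler_block_def)
  finally show ?thesis
    by (auto dest: has_sum_Re)
qed

lemma euler_block_nonneg: "euler_block k B t \<ge> 0"
  unfolding euler_block_def by (intro prod_nonneg) auto

text \<open>Rankin's trick: outside the truncation
  \<open>exp (a * (height B j - W)) \<ge> 1\<close>, so the discarded terms are dominated by the
  full moment, uniformly in \<open>t\<close>.\<close>

lemma euler_block_approx:
  assumes B: "finite B" "\<And>p. p \<in> B \<Longrightarrow> prime p" and a: "0 \<le> a" "a < 1"
  shows "\<bar>euler_block k B t - block_poly k B W t\<bar> \<le>
           exp (- (a * W)) * (\<Prod>p\<in>B. exp_moment k p (a * ln p))"
proof -
  let ?A = "B \<rightarrow>\<^sub>E (UNIV :: int set)" and ?J = "exponents B W"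
  let ?f = "\<lambda>j. block_coeff k B j * cos (t * freq B j)"
  let ?g = "\<lambda>j. exp (- (a * W)) * (block_coeff k B j * exp (a * height B j))"
  have J: "?J \<subseteq> ?A" by (auto simp: exponents_def)
  have "(?f has_sum (euler_block k B t - block_poly k B W t)) (?A - ?J)"
    by (rule has_sum_Diff[OF euler_block_has_sum[OF B] _ J])
       (auto intro!: has_sum_finiteI finite_exponents B simp: block_poly_def)
  hence h: "((\<lambda>j. if j \<in> ?J then 0 else ?f j) has_sum (euler_block k B t - block_poly k B W t)) ?A"
    by (subst (asm) has_sum_cong_neutral[where T = ?A and g = "\<lambda>j. if j \<in> ?J then 0 else ?f j"]) auto
  have g: "(?g has_sum exp (- (a * W)) * (\<Prod>p\<in>B. exp_moment k p (a * ln p))) ?A"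
    by (rule has_sum_cmult_right[OF block_coeff_exp_has_sum[OF assms]])
  have le: "\<bar>if j \<in> ?J then 0 else ?f j\<bar> \<le> ?g j" if "j \<in> ?A" for j
  proof (cases "j \<in> ?J")
    case False
    hence "W \<le> height B j" using that by (auto simp: exponents_def)
    hence "a * W \<le> a * height B j" using a by (intro mult_left_mono)
    hence "1 \<le> exp (- (a * W)) * exp (a * height B j)" by (simp flip: exp_add)
    from mult_left_mono[OF this block_coeff_nonneg[of k B j]]
    have "block_coeff k B j \<le> ?g j" by (simp add: mult_ac)
    moreover have "\<bar>?f j\<bar> \<le> block_coeff k B j * 1"
      unfolding abs_mult by (intro mult_mono) (auto simp: block_coeff_nonneg)
    ultimately show ?thesis using False by simp
  qed (auto simp: block_coeff_nonneg)
  have "euler_block k B t - block_poly k B W t \<le> exp (- (a * W)) * (\<Prod>p\<in>B. exp_moment k p (a * ln p))"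
    by (rule has_sum_mono[OF h g]) (use le in \<open>simp add: abs_le_iff\<close>)
  moreover have "- (euler_block k B t - block_poly k B W t) \<le> exp (- (a * W)) * (\<Prod>p\<in>B. exp_moment k p (a * ln p))"
    by (rule has_sum_mono[OF has_sum_uminusI[OF h] g]) (use le in \<open>simp add: abs_le_iff\<close>)
  ultimately show ?thesis by linarith
qed

text \<open>Lets the same moment bound also control the off-diagonal terms of the mean
  value.\<close>

lemma sum_block_coeff_le:
  assumes B: "finite B" "\<And>p. p \<in> B \<Longrightarrow> prime p" and a: "0 \<le> a" "a < 1"
  shows "(\<Sum>j\<in>exponents B W. block_coeff k B j) \<le> (\<Prod>p\<in>B. exp_moment k p (a * ln p))"
proof -
  have "((\<lambda>j. block_coeff k B j) has_sum (\<Sum>j\<in>exponents B W. block_coeff k B j)) (exponents B W)"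
    by (intro has_sum_finiteI finite_exponents B) auto
  thus ?thesis
  proof (rule has_sum_mono_neutral[OF _ block_coeff_exp_has_sum[OF assms]])
    fix j
    have "height B j \<ge> 0"
      unfolding height_def by (intro sum_nonneg) (use B(2) prime_ge_1_nat in force)
    hence "1 \<le> exp (a * height B j)" using a by simp
    from mult_left_mono[OF this block_coeff_nonneg[of k B j]]
    show "block_coeff k B j \<le> block_coeff k B j * exp (a * height B j)" by simp
  qed (auto simp: exponents_def block_coeff_nonneg)
qed

text \<open>The sines cancel under \<open>j \<mapsto> - j\<close>. The exponential form is the one
  in which products of blocks multiply out with additive frequencies.\<close>

lemma block_poly_cis:
  assumes B: "finite B" "\<And>p. p \<in> B \<Longrightarrow> prime p"
  shows "of_real (block_poly k B W t) = (\<Sum>j\<in>exponents B W. of_real (block_coeff k B j) * cis (t * freq B j))"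
proof -
  define neg where "neg = (\<lambda>j::nat \<Rightarrow> int. \<lambda>p\<in>B. - j p)"
  have neg: "neg j \<in> exponents B W" "neg (neg j) = j" if "j \<in> exponents B W" for j
    using that by (auto simp: neg_def exponents_def height_def restrict_def PiE_def extensional_def fun_eq_iff)
  have inv: "block_coeff k B (neg j) = block_coeff k B j" "freq B (neg j) = - freq B j" for j
    by (auto simp: neg_def block_coeff_def freq_def fourier_coeff_minus sum_negf intro!: prod.cong)
  define S where "S = (\<Sum>j\<in>exponents B W. block_coeff k B j * sin (t * freq B j))"
  have "S = (\<Sum>j\<in>exponents B W. - (block_coeff k B j * sin (t * freq B j)))"
    unfolding S_def
    by (rule sum.reindex_bij_witness[where i = neg and j = neg]) (auto simp: neg inv)
  hence "S = 0" by (simp add: S_def sum_negf)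
  thus ?thesis
    by (simp add: complex_eq_iff block_poly_def S_def)
qed

text \<open>The frequency is \<open>ln a - ln b\<close> for natural numbers with
  \<open>ln a + ln b \<le> W\<close>, distinct by unique factorization. For naturals
  \<open>x > y > 0\<close>, \<open>ln x - ln y \<ge> 1 - y / x \<ge> 1 / x\<close>.\<close>

lemma freq_lower_bound:
  assumes Q: "finite Q" "\<And>p. p \<in> Q \<Longrightarrow> prime p"
  assumes nz: "\<exists>p\<in>Q. j p \<noteq> 0" and W: "height Q j \<le> W"
  shows "exp (- W) \<le> \<bar>freq Q j\<bar>"
proof -
  have pos: "real p > 0" if "p \<in> Q" for p using Q(2)[OF that] prime_gt_0_nat by auto
  define a where "a = (\<Prod>p\<in>Q. p ^ nat (j p))"
  define b where "b = (\<Prod>p\<in>Q. p ^ nat (- j p))"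
  have ab: "a > 0" "b > 0" using pos by (auto simp: a_def b_def intro!: prod_pos)
  have lna: "ln (real a) = (\<Sum>p\<in>Q. nat (j p) * ln (real p))"
    unfolding a_def using pos Q(1) by (simp add: ln_prod ln_realpow)
  have lnb: "ln (real b) = (\<Sum>p\<in>Q. nat (- j p) * ln (real p))"
    unfolding b_def using pos Q(1) by (simp add: ln_prod ln_realpow)
  have fr: "freq Q j = ln a - ln b"
    unfolding lna lnb freq_def sum_subtractf[symmetric]
  proof (intro sum.cong refl)
    fix p
    show "of_int (j p) * ln (real p) = nat (j p) * ln (real p) - nat (- j p) * ln (real p)"
      by (cases "j p \<ge> 0") auto
  qed
  have he: "ln (real a) + ln (real b) \<le> W"
  proof -
    have "real (nat x) * c + real (nat (- x)) * c = \<bar>of_int x\<bar> * c" for x :: int and c :: real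
      by (cases "x \<ge> 0") auto
    hence "ln (real a) + ln (real b) = height Q j"
      unfolding lna lnb height_def by (simp flip: sum.distrib)
    with W show ?thesis by simp
  qed
  have neq: "a \<noteq> b"
  proof
    assume eq: "a = b"
    obtain p where p: "p \<in> Q" "j p \<noteq> 0" using nz by blast
    have "multiplicity p a = nat (j p)" "multiplicity p b = nat (- j p)"
      unfolding a_def b_def using Q p(1) by (simp_all add: multiplicity_prod_prime_powers)
    thus False using eq p(2) by auto
  qed
  have gap: "exp (- W) \<le> ln (real x) - ln (real y)"
    if "y < x" "y > 0" "ln (real x) + ln (real y) \<le> W" for x y :: nat
  proof -
    have x: "real x > 0" "real y \<ge> 1" "real x \<ge> real y + 1" using that by auto
    have "ln (real x) \<le> W" using that(3) ln_ge_zero[OF x(2)] by linarith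
    hence "exp (- W) \<le> exp (- ln (real x))" by simp
    also have "\<dots> = 1 / x" using x by (simp add: exp_minus field_simps)
    also have "\<dots> \<le> 1 - y / x" using x by (simp add: field_simps)
    also have "\<dots> \<le> - ln (y / x)" using ln_le_minus_one[of "y / x"] x by simp
    also have "\<dots> = ln (real x) - ln (real y)" using x by (simp add: ln_div)
    finally show ?thesis .
  qed
  show ?thesis
  proof (cases "b < a")
    case True
    thus ?thesis using gap[OF True] ab he fr by linarith
  next
    case False
    hence "a < b" using neq by simp
    thus ?thesis using gap[of a b] ab he fr by linarith
  qed
qed

section \<open>Mean values\<close>

lemma integral_cos_dyadic:
  fixes T u :: real
  assumes "T > 0" "u \<noteq> 0"
  shows "\<bar>integral {T..2*T} (\<lambda>t. cos (t * u))\<bar> \<le> 2 / \<bar>u\<bar>"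
proof -
  have "((\<lambda>t. cos (t * u)) has_integral (sin (2*T*u) / u - sin (T*u) / u)) {T..2*T}"
    by (rule fundamental_theorem_of_calculus)
       (use assms in \<open>auto intro!: derivative_eq_intros simp flip: has_real_derivative_iff_has_vector_derivative\<close>)
  hence "integral {T..2*T} (\<lambda>t. cos (t * u)) = (sin (2*T*u) - sin (T*u)) / u"
    by (simp add: integral_unique diff_divide_distrib)
  moreover have "\<bar>sin (2*T*u) - sin (T*u)\<bar> \<le> 2"
    using sin_le_one[of "2*T*u"] sin_le_one[of "T*u"] sin_ge_minus_one[of "2*T*u"] sin_ge_minus_one[of "T*u"]
    by linarith
  ultimately show ?thesis by (simp add: divide_right_mono)
qed

text \<open>Here \<open>z i\<close> is the index of the constant term of \<open>P i\<close>. After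
  multiplying out, only the choice \<open>z\<close> has mean value 1; any other frequency is at
  least \<open>\<delta>\<close> and integrates to at most \<open>2 / \<delta>\<close>. Nonnegativity
  of \<open>c\<close> lets the error be summed back into a product.\<close>

lemma mean_value_product:
  fixes c :: "'i \<Rightarrow> 'j \<Rightarrow> real" and u :: "'i \<Rightarrow> 'j \<Rightarrow> real" and P :: "'i \<Rightarrow> real \<Rightarrow> real"
  assumes fin: "finite I" "\<And>i. i \<in> I \<Longrightarrow> finite (J i)"
    and c: "\<And>i j. i \<in> I \<Longrightarrow> j \<in> J i \<Longrightarrow> c i j \<ge> 0"
    and z: "\<And>i. i \<in> I \<Longrightarrow> z i \<in> J i" "\<And>i. i \<in> I \<Longrightarrow> u i (z i) = 0"
    and gap: "\<And>\<phi>. \<phi> \<in> PiE I J \<Longrightarrow> \<exists>i\<in>I. \<phi> i \<noteq> z i \<Longrightarrow> \<delta> \<le> \<bar>\<Sum>i\<in>I. u i (\<phi> i)\<bar>"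
    and P: "\<And>i t. i \<in> I \<Longrightarrow> of_real (P i t) = (\<Sum>j\<in>J i. of_real (c i j) * cis (t * u i j))"
    and pos: "\<delta> > 0" "T > 0"
  shows "\<bar>integral {T..2*T} (\<lambda>t. \<Prod>i\<in>I. P i t) / T - (\<Prod>i\<in>I. c i (z i))\<bar>
           \<le> 2 / (T * \<delta>) * (\<Prod>i\<in>I. \<Sum>j\<in>J i. c i j)"
proof -
  define C where "C = (\<lambda>\<phi>. \<Prod>i\<in>I. c i (\<phi> i))"
  define U where "U = (\<lambda>\<phi>. \<Sum>i\<in>I. u i (\<phi> i))"
  define z' where "z' = restrict z I"
  have finP: "finite (PiE I J)" using fin by (intro finite_PiE) auto
  have z': "z' \<in> PiE I J" using z by (auto simp: z'_def)
  have C0: "C \<phi> \<ge> 0" if "\<phi> \<in> PiE I J" for \<phi>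
    unfolding C_def using that c by (intro prod_nonneg) (auto simp: PiE_iff)
  have expand: "(\<Prod>i\<in>I. P i t) = (\<Sum>\<phi>\<in>PiE I J. C \<phi> * cos (t * U \<phi>))" for t
  proof -
    have "complex_of_real (\<Prod>i\<in>I. P i t) = (\<Prod>i\<in>I. \<Sum>j\<in>J i. of_real (c i j) * cis (t * u i j))"
      by (simp add: P)
    also have "\<dots> = (\<Sum>\<phi>\<in>PiE I J. \<Prod>i\<in>I. of_real (c i (\<phi> i)) * cis (t * u i (\<phi> i)))"
      using fin by (rule prod_sum_PiE)
    also have "\<dots> = (\<Sum>\<phi>\<in>PiE I J. of_real (C \<phi>) * cis (t * U \<phi>))"
      by (simp add: C_def U_def prod.distrib sum_distrib_left cis_sum)
    finally have "Re (complex_of_real (\<Prod>i\<in>I. P i t)) = Re \<dots>" by (rule arg_cong)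
    thus ?thesis by (simp del: of_real_prod)
  qed
  define K where "K = (\<lambda>\<phi>. integral {T..2*T} (\<lambda>t. cos (t * U \<phi>)))"
  have int: "integral {T..2*T} (\<lambda>t. \<Prod>i\<in>I. P i t) = (\<Sum>\<phi>\<in>PiE I J. C \<phi> * K \<phi>)"
    unfolding expand K_def using finP
    by (subst integral_sum) (auto intro!: integrable_continuous_interval continuous_intros)
  have Kz: "K z' = T"
  proof -
    have "U z' = 0" using z by (auto simp: U_def z'_def intro!: sum.neutral)
    thus ?thesis using pos by (simp add: K_def)
  qed
  have Cz: "C z' = (\<Prod>i\<in>I. c i (z i))" by (simp add: C_def z'_def)
  have K: "\<bar>K \<phi>\<bar> \<le> 2 / \<delta>" if "\<phi> \<in> PiE I J - {z'}" for \<phi>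
  proof -
    have "\<exists>i\<in>I. \<phi> i \<noteq> z i"
    proof (rule ccontr)
      assume "\<not> (\<exists>i\<in>I. \<phi> i \<noteq> z i)"
      hence "\<phi> = z'" using that by (auto simp: z'_def fun_eq_iff restrict_def PiE_def extensional_def)
      thus False using that by simp
    qed
    hence d: "\<delta> \<le> \<bar>U \<phi>\<bar>" unfolding U_def using that by (intro gap) auto
    have "\<bar>K \<phi>\<bar> \<le> 2 / \<bar>U \<phi>\<bar>" unfolding K_def
      by (rule integral_cos_dyadic) (use pos d in auto)
    also have "\<dots> \<le> 2 / \<delta>" using d pos by (intro divide_left_mono) auto
    finally show ?thesis .
  qed
  have "integral {T..2*T} (\<lambda>t. \<Prod>i\<in>I. P i t) = C z' * T + (\<Sum>\<phi>\<in>PiE I J - {z'}. C \<phi> * K \<phi>)"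
    unfolding int sum.remove[OF finP z'] Kz ..
  hence "\<bar>integral {T..2*T} (\<lambda>t. \<Prod>i\<in>I. P i t) / T - C z'\<bar> = \<bar>\<Sum>\<phi>\<in>PiE I J - {z'}. C \<phi> * K \<phi>\<bar> / T"
    using pos by (simp add: add_divide_distrib)
  also have "\<bar>\<Sum>\<phi>\<in>PiE I J - {z'}. C \<phi> * K \<phi>\<bar> \<le> (\<Sum>\<phi>\<in>PiE I J - {z'}. C \<phi> * (2 / \<delta>))"
  proof (rule order_trans[OF sum_abs sum_mono])
    fix \<phi> assume \<phi>: "\<phi> \<in> PiE I J - {z'}"
    thus "\<bar>C \<phi> * K \<phi>\<bar> \<le> C \<phi> * (2 / \<delta>)"
      using mult_left_mono[OF K[OF \<phi>], of "C \<phi>"] C0[of \<phi>] \<phi> by (simp add: abs_mult)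
  qed
  also have "\<dots> \<le> (\<Sum>\<phi>\<in>PiE I J. C \<phi> * (2 / \<delta>))"
    by (rule sum_mono2[OF finP]) (use C0 pos in \<open>auto intro!: mult_nonneg_nonneg\<close>)
  also have "\<dots> = (2 / \<delta>) * (\<Prod>i\<in>I. \<Sum>j\<in>J i. c i j)"
    using fin by (simp add: C_def prod_sum_PiE sum_distrib_left mult_ac)
  finally show ?thesis using pos unfolding Cz by (simp add: divide_right_mono mult_ac)
qed

section \<open>From the majorants to the product itself\<close>

lemma prod_diff_le:
  fixes f g :: "'i \<Rightarrow> real"
  assumes "finite I" "\<And>i. i \<in> I \<Longrightarrow> 0 \<le> f i" "\<And>i. i \<in> I \<Longrightarrow> f i \<le> g i"
  shows "prod g I - prod f I \<le> (\<Sum>i\<in>I. (g i - f i) * prod g (I - {i}))"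
  using assms
proof (induction I rule: finite_induct)
  case (insert x I)
  have "prod g (insert x I) - prod f (insert x I) = (g x - f x) * prod g I + f x * (prod g I - prod f I)"
    using insert by (simp add: algebra_simps)
  also have "f x * (prod g I - prod f I) \<le> g x * (\<Sum>i\<in>I. (g i - f i) * prod g (I - {i}))"
  proof (rule mult_mono)
    show "prod g I - prod f I \<ge> 0" using insert by (simp add: prod_mono)
  qed (use insert order_trans in \<open>auto, force\<close>)
  also have "\<dots> = (\<Sum>i\<in>I. (g i - f i) * prod g (insert x I - {i}))"
    unfolding sum_distrib_left
  proof (rule sum.cong[OF refl])
    fix i assume "i \<in> I"
    hence "insert x I - {i} = insert x (I - {i})" using insert(2) by auto
    thus "g x * ((g i - f i) * prod g (I - {i})) = (g i - f i) * prod g (insert x I - {i})"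
      using insert(1,2) by simp
  qed
  also have "(g x - f x) * prod g I = (g x - f x) * prod g (insert x I - {x})"
    using insert(2) by simp
  finally show ?case using insert(1,2) by simp
qed auto

text \<open>Pointwise errors cannot be multiplied by the sizes of the other blocks, which vary
  wildly with \<open>t\<close>; the means of subproducts of the majorants \<open>g\<close> replace
  them. The upper bound is \<open>f \<le> g\<close>. For the lower bound, replacing block
  \<open>i\<close> costs \<open>2 * \<epsilon> * D i\<close> times the mean over
  \<open>I - {i}\<close>.\<close>

lemma mean_value_sandwich:
  fixes f g :: "'i \<Rightarrow> real \<Rightarrow> real" and D :: "'i \<Rightarrow> real"
  assumes fin: "finite I" and T: "T > 0"
    and cont: "\<And>i. i \<in> I \<Longrightarrow> continuous_on UNIV (f i)" "\<And>i. i \<in> I \<Longrightarrow> continuous_on UNIV (g i)"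
    and fg: "\<And>i t. i \<in> I \<Longrightarrow> 0 \<le> f i t" "\<And>i t. i \<in> I \<Longrightarrow> f i t \<le> g i t"
      "\<And>i t. i \<in> I \<Longrightarrow> g i t \<le> f i t + 2 * \<epsilon> * D i"
    and D: "\<And>i. i \<in> I \<Longrightarrow> D i > 0" and \<epsilon>: "\<epsilon> > 0" "real (card I + 1) * \<epsilon> \<le> 1"
    and mean: "\<And>I'. I' \<subseteq> I \<Longrightarrow>
      \<bar>integral {T..2*T} (\<lambda>t. \<Prod>i\<in>I'. g i t) / T - (\<Prod>i\<in>I'. D i * (1 + \<epsilon>))\<bar> \<le> \<epsilon> * (\<Prod>i\<in>I'. D i * (1 + \<epsilon>))"
  shows "\<bar>integral {T..2*T} (\<lambda>t. \<Prod>i\<in>I. f i t) / T - (\<Prod>i\<in>I. D i)\<bar>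
           \<le> 8 * real (card I + 1) * \<epsilon> * (\<Prod>i\<in>I. D i)"
proof -
  define N where "N = card I"
  define DD where "DD = (\<Prod>i\<in>I. D i)"
  \<comment> \<open>One factor \<open>1 + \<epsilon>\<close> comes from each block and one more from
    the error in \<open>mean\<close>; since \<open>(N + 1) * \<epsilon> \<le> 1\<close>,
    \<open>q\<close> exceeds 1 by at most \<open>2 * (N + 1) * \<epsilon>\<close>.\<close>
  define q where "q = (1 + \<epsilon>) ^ (N + 1)"
  define M where "M = (\<lambda>h. integral {T..2*T} h / T)"
  have DD: "DD > 0" unfolding DD_def using D by (intro prod_pos) auto
  have pD: "(\<Prod>i\<in>I'. D i * (1 + \<epsilon>)) = (\<Prod>i\<in>I'. D i) * (1 + \<epsilon>) ^ card I'" for I'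
    by (simp add: prod.distrib)
  have integ: "(\<lambda>t. \<Prod>i\<in>I'. g i t) integrable_on {T..2*T}" if "I' \<subseteq> I" for I'
    using that cont continuous_on_subset
    by (intro integrable_continuous_interval continuous_on_prod) blast
  have integf: "(\<lambda>t. \<Prod>i\<in>I. f i t) integrable_on {T..2*T}"
    using cont continuous_on_subset
    by (intro integrable_continuous_interval continuous_on_prod) blast
  have "q \<le> exp \<epsilon> ^ (N + 1)"
    unfolding q_def using \<epsilon> by (intro power_mono) (auto simp: exp_ge_add_one_self)
  also have "\<dots> = exp ((N + 1) * \<epsilon>)" by (simp only: exp_of_nat_mult)
  also have "\<dots> \<le> 1 + (N + 1) * \<epsilon> + ((N + 1) * \<epsilon>)\<^sup>2"
    using \<epsilon> by (intro exp_bound) (auto simp: N_def)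
  also have "((N + 1) * \<epsilon>)\<^sup>2 \<le> (N + 1) * \<epsilon> * 1"
    unfolding power2_eq_square using \<epsilon> by (intro mult_left_mono) (auto simp: N_def)
  finally have q2: "q \<le> 1 + 2 * ((N + 1) * \<epsilon>)" by (simp add: algebra_simps)
  have q3: "q \<le> 3" using q2 \<epsilon>(2) by (simp add: N_def)
  have qN: "(1 + \<epsilon>) ^ N * (1 + \<epsilon>) = q" by (simp add: q_def)
  have pN: "(1 + \<epsilon>) ^ N \<ge> 1" by (rule one_le_power) (use \<epsilon> in simp)
  have gI: "\<bar>M (\<lambda>t. \<Prod>i\<in>I. g i t) - DD * (1 + \<epsilon>) ^ N\<bar> \<le> \<epsilon> * (DD * (1 + \<epsilon>) ^ N)"
    using mean[of I] unfolding M_def pD DD_def N_def by simp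
  have eq: "DD * (1 + \<epsilon>) ^ N + \<epsilon> * (DD * (1 + \<epsilon>) ^ N) = DD * q"
    unfolding qN[symmetric] by (simp add: algebra_simps)
  have up: "M (\<lambda>t. \<Prod>i\<in>I. f i t) \<le> DD * q"
  proof -
    have "M (\<lambda>t. \<Prod>i\<in>I. f i t) \<le> M (\<lambda>t. \<Prod>i\<in>I. g i t)"
      unfolding M_def using T
      by (intro divide_right_mono integral_le integf integ prod_mono) (auto simp: fg)
    thus ?thesis using gI eq unfolding abs_le_iff by linarith
  qed
  have rest: "M (\<lambda>t. 2 * \<epsilon> * D i * (\<Prod>l\<in>I - {i}. g l t)) \<le> 2 * \<epsilon> * (DD * q)" if i: "i \<in> I" for i
  proof -
    have "M (\<lambda>t. \<Prod>l\<in>I - {i}. g l t) \<le> (1 + \<epsilon>) * (\<Prod>l\<in>I - {i}. D l * (1 + \<epsilon>))"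
      using mean[of "I - {i}"] unfolding M_def abs_le_iff by (simp add: algebra_simps)
    also have "\<dots> = (\<Prod>l\<in>I - {i}. D l) * (1 + \<epsilon>) ^ N"
      by (simp add: pD N_def card.remove[OF fin i])
    also have "\<dots> \<le> (\<Prod>l\<in>I - {i}. D l) * q"
    proof (rule mult_left_mono)
      show "(1 + \<epsilon>) ^ N \<le> q" unfolding qN[symmetric] using \<epsilon> pN by simp
      show "(\<Prod>l\<in>I - {i}. D l) \<ge> 0" using D by (intro prod_nonneg) (auto intro: less_imp_le)
    qed
    finally have "2 * \<epsilon> * D i * M (\<lambda>t. \<Prod>l\<in>I - {i}. g l t) \<le> 2 * \<epsilon> * D i * ((\<Prod>l\<in>I - {i}. D l) * q)"
      using \<epsilon> D[OF i] by (intro mult_left_mono) auto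
    also have "\<dots> = 2 * \<epsilon> * (DD * q)"
      unfolding DD_def prod.remove[OF fin i] by simp
    finally show ?thesis by (simp add: M_def)
  qed
  have low: "M (\<lambda>t. \<Prod>i\<in>I. f i t) \<ge> M (\<lambda>t. \<Prod>i\<in>I. g i t) - N * (2 * \<epsilon> * (DD * q))"
  proof -
    let ?r = "\<lambda>i t. 2 * \<epsilon> * D i * (\<Prod>l\<in>I - {i}. g l t)"
    have ir: "?r i integrable_on {T..2*T}" for i
      by (rule integrable_on_mult_right) (rule integ, auto)
    have "integral {T..2*T} (\<lambda>t. \<Prod>i\<in>I. g i t) \<le>
            integral {T..2*T} (\<lambda>t. (\<Prod>i\<in>I. f i t) + (\<Sum>i\<in>I. ?r i t))"
    proof (rule integral_le)
      show "(\<lambda>t. (\<Prod>i\<in>I. f i t) + (\<Sum>i\<in>I. ?r i t)) integrable_on {T..2*T}"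
        by (intro integrable_add integf integrable_sum fin ir)
      fix t
      have "(\<Prod>i\<in>I. g i t) - (\<Prod>i\<in>I. f i t) \<le> (\<Sum>i\<in>I. (g i t - f i t) * (\<Prod>l\<in>I - {i}. g l t))"
        using prod_diff_le[OF fin, of "\<lambda>i. f i t" "\<lambda>i. g i t"] fg by simp
      also have "\<dots> \<le> (\<Sum>i\<in>I. ?r i t)"
      proof (intro sum_mono mult_right_mono)
        fix i assume i: "i \<in> I"
        show "g i t - f i t \<le> 2 * \<epsilon> * D i" using fg(3)[OF i, of t] by simp
        show "(\<Prod>l\<in>I - {i}. g l t) \<ge> 0"
          using fg(1,2) order_trans by (intro prod_nonneg) blast
      qed
      finally show "(\<Prod>i\<in>I. g i t) \<le> (\<Prod>i\<in>I. f i t) + (\<Sum>i\<in>I. ?r i t)" by simp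
    qed (rule integ, simp)
    also have "\<dots> = integral {T..2*T} (\<lambda>t. \<Prod>i\<in>I. f i t) + (\<Sum>i\<in>I. integral {T..2*T} (?r i))"
      by (subst integral_add) (auto intro!: integf integrable_sum fin ir simp del: Henstock_Kurzweil_Integration.integral_mult_right simp: integral_sum[OF fin ir])
    finally have "M (\<lambda>t. \<Prod>i\<in>I. g i t) \<le> M (\<lambda>t. \<Prod>i\<in>I. f i t) + (\<Sum>i\<in>I. M (?r i))"
      unfolding M_def sum_divide_distrib[symmetric] add_divide_distrib[symmetric]
      using T by (intro divide_right_mono) auto
    also have "(\<Sum>i\<in>I. M (?r i)) \<le> (\<Sum>i\<in>I. 2 * \<epsilon> * (DD * q))" by (intro sum_mono rest)
    finally show ?thesis by (simp add: N_def)
  qed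
  have e1: "N * (2 * \<epsilon> * (DD * q)) \<le> 6 * ((N + 1) * \<epsilon>) * DD"
  proof -
    have "N * (2 * \<epsilon> * (DD * q)) = 2 * (N * \<epsilon> * DD) * q" by simp
    also have "\<dots> \<le> 2 * (N * \<epsilon> * DD) * 3" using q3 \<epsilon> DD by (intro mult_left_mono) auto
    also have "\<dots> \<le> 6 * ((N + 1) * \<epsilon>) * DD" using \<epsilon> DD by (simp add: algebra_simps)
    finally show ?thesis .
  qed
  have e2: "DD * q \<le> DD + 2 * ((N + 1) * \<epsilon>) * DD"
    using mult_left_mono[OF q2, of DD] DD by (simp add: algebra_simps)
  have e3: "DD * (1 + \<epsilon>) ^ N - \<epsilon> * (DD * (1 + \<epsilon>) ^ N) \<ge> DD - 2 * ((N + 1) * \<epsilon>) * DD"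
  proof -
    have "DD * 1 \<le> DD * (1 + \<epsilon>) ^ N" using pN DD by (intro mult_left_mono) auto
    thus ?thesis using e2 eq by linarith
  qed
  have "0 \<le> 6 * ((N + 1) * \<epsilon>) * DD" using \<epsilon> DD by simp
  \<comment> \<open>The constant 8 is 6 from replacing the blocks and 2 from the deviation of the
    mean of the majorants.\<close>
  hence "\<bar>M (\<lambda>t. \<Prod>i\<in>I. f i t) - DD\<bar> \<le> 8 * ((N + 1) * \<epsilon>) * DD"
    using up low gI e1 e2 e3 unfolding abs_le_iff by linarith
  thus ?thesis by (simp add: M_def DD_def N_def algebra_simps)
qed

lemma euler_block_continuous:
  assumes "finite B" "\<And>p. p \<in> B \<Longrightarrow> prime p"
  shows "continuous_on UNIV (euler_block k B)"
proof -
  have "1 - cis (- (t * ln (real p))) / of_nat p \<noteq> 0" if "p \<in> B" for p t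
  proof
    assume "1 - cis (- (t * ln (real p))) / of_nat p = 0"
    hence "norm (cis (- (t * ln (real p))) / of_nat p) = 1" by simp
    thus False using prime_gt_1_nat[OF assms(2)[OF that]] by (simp add: norm_divide)
  qed
  thus ?thesis
    unfolding euler_block_def[abs_def] cis_conv_exp
    using prime_gt_0_nat[OF assms(2)] by (intro continuous_intros) auto
qed

text \<open>The moment hypothesis turns Rankin's bound into the pointwise error
  \<open>\<epsilon> * D i\<close> of each truncated block. The heights add up to at most
  \<open>ln T / 2\<close>, so the nonzero frequencies of a product of truncations are at least
  \<open>exp (- (ln T / 2))\<close>.\<close>

lemma euler_product_mean:
  fixes T :: real
  assumes fin: "finite I" "\<And>i. i \<in> I \<Longrightarrow> finite (B i)"
    and prm: "\<And>i p. i \<in> I \<Longrightarrow> p \<in> B i \<Longrightarrow> prime p"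
    and disj: "disjoint_family_on B I"
    and T: "T > 0"
    and a: "\<And>i. i \<in> I \<Longrightarrow> 0 \<le> a i \<and> a i \<le> 1 / 4" and W: "\<And>i. i \<in> I \<Longrightarrow> W i \<ge> 0"
    and Wsum: "(\<Sum>i\<in>I. W i) \<le> ln T / 2"
    and \<epsilon>: "\<epsilon> > 0" "real (card I + 1) * \<epsilon> \<le> 1" "2 * exp (- (3 / 8) * ln T) \<le> \<epsilon>"
    and moment: "\<And>i. i \<in> I \<Longrightarrow> (\<Prod>p\<in>B i. exp_moment k p (a i * ln p))
        \<le> \<epsilon> * exp (a i * W i) * (\<Prod>p\<in>B i. fourier_coeff k p 0)"
  shows "\<bar>integral {T..2*T} (\<lambda>t. \<Prod>i\<in>I. euler_block k (B i) t) / T - (\<Prod>i\<in>I. \<Prod>p\<in>B i. fourier_coeff k p 0)\<bar>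
           \<le> 8 * real (card I + 1) * \<epsilon> * (\<Prod>i\<in>I. \<Prod>p\<in>B i. fourier_coeff k p 0)"
proof -
  define D where "D = (\<lambda>i. \<Prod>p\<in>B i. fourier_coeff k p 0)"
  define z where "z = (\<lambda>i. \<lambda>p\<in>B i. (0::int))"
  define J where "J = (\<lambda>i. exponents (B i) (W i))"
  \<comment> \<open>Adding the constant \<open>\<epsilon> * D i\<close> to the truncated block
    changes only its coefficient at the zero exponent vector \<open>z i\<close>.\<close>
  define c where "c = (\<lambda>i j. block_coeff k (B i) j + (if j = z i then \<epsilon> * D i else 0))"
  define g where "g = (\<lambda>i t. block_poly k (B i) (W i) t + \<epsilon> * D i)"
  have D: "D i > 0" if "i \<in> I" for i
    unfolding D_def using fourier_coeff_0_ge_1[OF prm[OF that]]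
    by (intro prod_pos) (auto intro: less_le_trans[OF zero_less_one])
  have finJ: "finite (J i)" if "i \<in> I" for i
    unfolding J_def using that fin prm by (intro finite_exponents) auto
  have zJ: "z i \<in> J i" if "i \<in> I" for i
    using W[OF that] by (auto simp: z_def J_def exponents_def height_def)
  have uz: "freq (B i) (z i) = 0" for i by (simp add: z_def freq_def)
  have cz: "c i (z i) = D i * (1 + \<epsilon>)" for i
    by (simp add: c_def block_coeff_def D_def z_def algebra_simps)
  have c0: "c i j \<ge> 0" if "i \<in> I" for i j
    using D[OF that] \<epsilon> by (auto simp: c_def block_coeff_nonneg intro!: add_nonneg_nonneg)
  have approx: "\<bar>euler_block k (B i) t - block_poly k (B i) (W i) t\<bar> \<le> \<epsilon> * D i" if i: "i \<in> I" for i t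
  proof -
    have "\<bar>euler_block k (B i) t - block_poly k (B i) (W i) t\<bar> \<le>
        exp (- (a i * W i)) * (\<Prod>p\<in>B i. exp_moment k p (a i * ln p))"
      using fin(2)[OF i] prm[OF i] a[OF i] by (intro euler_block_approx) auto
    also have "\<dots> \<le> exp (- (a i * W i)) * (\<epsilon> * exp (a i * W i) * D i)"
      unfolding D_def by (rule mult_left_mono[OF moment[OF i]]) auto
    also have "\<dots> = \<epsilon> * D i" by (simp add: exp_minus)
    finally show ?thesis .
  qed
  have gcis: "of_real (g i t) = (\<Sum>j\<in>J i. of_real (c i j) * cis (t * freq (B i) j))" if i: "i \<in> I" for i t
  proof -
    have "(\<Sum>j\<in>J i. of_real (if j = z i then \<epsilon> * D i else 0) * cis (t * freq (B i) j)) =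
      (\<Sum>j\<in>J i. if j = z i then complex_of_real (\<epsilon> * D i) else 0)"
      by (intro sum.cong) (auto simp: uz)
    also have "\<dots> = complex_of_real (\<epsilon> * D i)"
      using finJ[OF i] zJ[OF i] by (subst sum.delta) auto
    finally show ?thesis
      using fin(2)[OF i] prm[OF i]
      by (simp add: g_def c_def block_poly_cis J_def distrib_right sum.distrib)
  qed
  have gap: "exp (- (ln T / 2)) \<le> \<bar>\<Sum>i\<in>I'. freq (B i) (\<phi> i)\<bar>"
    if I': "I' \<subseteq> I" and \<phi>: "\<phi> \<in> PiE I' J" and ne: "\<exists>i\<in>I'. \<phi> i \<noteq> z i" for I' \<phi>
  proof -
    \<comment> \<open>The blocks are disjoint, so exponent vectors chosen per block merge into one
      vector \<open>j\<close> on their union. Frequencies and heights add, and the lower bound for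
      the union applies.\<close>
    define blk where "blk = (\<lambda>p. THE i. i \<in> I' \<and> p \<in> B i)"
    have blk: "blk p = i" if "i \<in> I'" "p \<in> B i" for i p
      unfolding blk_def using that disj I'
      by (intro the_equality) (auto simp: disjoint_family_on_def)
    define j where "j = (\<lambda>p. \<phi> (blk p) p)"
    have finI': "finite I'" using I' fin finite_subset by blast
    have un: "(\<Sum>p\<in>(\<Union>i\<in>I'. B i). h p) = (\<Sum>i\<in>I'. \<Sum>p\<in>B i. h p)" for h :: "nat \<Rightarrow> real"
      using disj I' fin finI' by (intro sum.UNION_disjoint) (auto simp: disjoint_family_on_def)
    have fr: "freq (\<Union>i\<in>I'. B i) j = (\<Sum>i\<in>I'. freq (B i) (\<phi> i))"
      unfolding freq_def un by (intro sum.cong) (auto simp: j_def blk)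
    have "height (\<Union>i\<in>I'. B i) j = (\<Sum>i\<in>I'. height (B i) (\<phi> i))"
      unfolding height_def un by (intro sum.cong) (auto simp: j_def blk)
    also have "\<dots> \<le> (\<Sum>i\<in>I'. W i)"
      using \<phi> by (intro sum_mono) (auto simp: PiE_iff J_def exponents_def)
    also have "\<dots> \<le> (\<Sum>i\<in>I. W i)" using I' W fin by (intro sum_mono2) auto
    finally have he: "height (\<Union>i\<in>I'. B i) j \<le> ln T / 2" using Wsum by simp
    obtain i where i: "i \<in> I'" "\<phi> i \<noteq> z i" using ne by blast
    have "\<exists>p\<in>B i. \<phi> i p \<noteq> 0"
    proof (rule ccontr)
      assume "\<not> ?thesis"
      moreover have "\<phi> i \<in> extensional (B i)" using \<phi> i by (auto simp: PiE_iff J_def exponents_def)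
      ultimately have "\<phi> i = z i" by (auto simp: z_def fun_eq_iff extensional_def)
      thus False using i by simp
    qed
    hence "\<exists>p\<in>(\<Union>i\<in>I'. B i). j p \<noteq> 0" using i by (auto simp: j_def blk intro!: bexI[of _ i])
    from freq_lower_bound[OF _ _ this he] show ?thesis
      unfolding fr using I' fin finI' prm by blast
  qed
  have csum: "(\<Sum>j\<in>J i. c i j) \<le> D i * (1 + \<epsilon>) * exp (a i * W i)" if i: "i \<in> I" for i
  proof -
    have "(\<Sum>j\<in>J i. c i j) = (\<Sum>j\<in>J i. block_coeff k (B i) j) + \<epsilon> * D i"
      using finJ[OF i] zJ[OF i] by (simp add: c_def sum.distrib sum.delta)
    also have "(\<Sum>j\<in>J i. block_coeff k (B i) j) \<le> (\<Prod>p\<in>B i. exp_moment k p (a i * ln p))"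
      unfolding J_def using fin(2)[OF i] prm[OF i] a[OF i] by (intro sum_block_coeff_le) auto
    also have "\<dots> \<le> \<epsilon> * exp (a i * W i) * D i" using moment[OF i] by (simp add: D_def)
    also have "\<epsilon> * D i \<le> exp (a i * W i) * D i"
    proof (rule mult_right_mono)
      have "\<epsilon> \<le> real (card I + 1) * \<epsilon>" using \<epsilon> by (simp add: algebra_simps)
      hence "\<epsilon> \<le> 1" using \<epsilon> by linarith
      also have "1 \<le> exp (a i * W i)" using a[OF i] W[OF i] by simp
      finally show "\<epsilon> \<le> exp (a i * W i)" .
    qed (use D[OF i] in auto)
    finally show ?thesis by (simp add: algebra_simps)
  qed
  have "\<bar>integral {T..2*T} (\<lambda>t. \<Prod>i\<in>I. euler_block k (B i) t) / T - (\<Prod>i\<in>I. D i)\<bar>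
           \<le> 8 * real (card I + 1) * \<epsilon> * (\<Prod>i\<in>I. D i)"
  proof (rule mean_value_sandwich[where g = g])
    fix i t assume i: "i \<in> I"
    show "continuous_on UNIV (euler_block k (B i))"
      using fin(2)[OF i] prm[OF i] by (rule euler_block_continuous)
    show "continuous_on UNIV (g i)"
      unfolding g_def block_poly_def by (intro continuous_intros)
    show "0 \<le> euler_block k (B i) t" by (rule euler_block_nonneg)
    show "euler_block k (B i) t \<le> g i t" "g i t \<le> euler_block k (B i) t + 2 * \<epsilon> * D i"
      using approx[OF i, of t] by (auto simp: g_def abs_le_iff)
    show "D i > 0" by (rule D[OF i])
  next
    fix I' assume I': "I' \<subseteq> I"
    have finI': "finite I'" using I' fin finite_subset by blast
    have "\<bar>integral {T..2*T} (\<lambda>t. \<Prod>i\<in>I'. g i t) / T - (\<Prod>i\<in>I'. c i (z i))\<bar>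
           \<le> 2 / (T * exp (- (ln T / 2))) * (\<Prod>i\<in>I'. \<Sum>j\<in>J i. c i j)"
      by (rule mean_value_product[where u = "\<lambda>i. freq (B i)"])
         (use I' finI' finJ zJ c0 uz gcis T gap in auto)
    also have "2 / (T * exp (- (ln T / 2))) = 2 * exp (- (ln T / 2))"
    proof -
      have "T = exp (ln T)" using T by simp
      also have "exp (ln T) * exp (- (ln T / 2)) = exp (ln T / 2)" by (simp flip: exp_add)
      finally show ?thesis using T by (simp add: exp_minus field_simps)
    qed
    also have "(\<Prod>i\<in>I'. \<Sum>j\<in>J i. c i j) \<le> (\<Prod>i\<in>I'. D i * (1 + \<epsilon>) * exp (a i * W i))"
      using I' csum c0 by (intro prod_mono) (auto intro!: sum_nonneg)
    also have "\<dots> = (\<Prod>i\<in>I'. D i * (1 + \<epsilon>)) * exp (\<Sum>i\<in>I'. a i * W i)"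
      using finI' by (simp add: prod.distrib exp_sum)
    also have "\<dots> \<le> (\<Prod>i\<in>I'. D i * (1 + \<epsilon>)) * exp (ln T / 8)"
    proof (rule mult_left_mono)
      have "(\<Sum>i\<in>I'. a i * W i) \<le> (\<Sum>i\<in>I'. 1 / 4 * W i)"
        using a W I' by (intro sum_mono mult_right_mono) auto
      also have "\<dots> \<le> (\<Sum>i\<in>I. 1 / 4 * W i)" using I' W fin by (intro sum_mono2) auto
      also have "\<dots> = 1 / 4 * (\<Sum>i\<in>I. W i)" by (simp add: sum_distrib_left)
      finally show "exp (\<Sum>i\<in>I'. a i * W i) \<le> exp (ln T / 8)" using Wsum by simp
      show "(\<Prod>i\<in>I'. D i * (1 + \<epsilon>)) \<ge> 0"
        using D I' \<epsilon> by (intro prod_nonneg) (auto intro!: mult_nonneg_nonneg less_imp_le)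
    qed
    finally have "\<bar>integral {T..2*T} (\<lambda>t. \<Prod>i\<in>I'. g i t) / T - (\<Prod>i\<in>I'. D i * (1 + \<epsilon>))\<bar>
       \<le> 2 * exp (- (ln T / 2)) * ((\<Prod>i\<in>I'. D i * (1 + \<epsilon>)) * exp (ln T / 8))"
      by (simp add: cz)
    \<comment> \<open>The exponent 3/8 is 1/2 from the frequency gap, less 1/8 from the moments:
      \<open>a i \<le> 1 / 4\<close> and the \<open>W i\<close> sum to at most
      \<open>ln T / 2\<close>.\<close>
    also have "\<dots> = 2 * exp (- (3 / 8) * ln T) * (\<Prod>i\<in>I'. D i * (1 + \<epsilon>))"
      by (simp add: mult_ac flip: exp_add)
    also have "\<dots> \<le> \<epsilon> * (\<Prod>i\<in>I'. D i * (1 + \<epsilon>))"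
      using D I' \<epsilon> by (intro mult_right_mono prod_nonneg) (auto intro!: mult_nonneg_nonneg less_imp_le)
    finally show "\<bar>integral {T..2*T} (\<lambda>t. \<Prod>i\<in>I'. g i t) / T - (\<Prod>i\<in>I'. D i * (1 + \<epsilon>))\<bar>
        \<le> \<epsilon> * (\<Prod>i\<in>I'. D i * (1 + \<epsilon>))" .
  qed (use fin T \<epsilon> in auto)
  thus ?thesis by (simp add: D_def)
qed

section \<open>Reciprocals of primes and size conditions\<close>

text \<open>By Chebyshev's bound each of the dyadic intervals numbered \<open>K\<close> to
  \<open>m\<close> contributes at most \<open>4 / (K + 1)\<close>.\<close>

lemma sum_reciprocal_primes_le:
  assumes y: "y < 2 ^ (m + 1)"
  shows "(\<Sum>p | prime p \<and> 2 ^ K < p \<and> real p \<le> y. 1 / real p) \<le> 4 * real (m + 1 - K) / real (K + 1)"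
proof -
  define B where "B = (\<lambda>i. {p::nat. prime p \<and> 2 ^ i < p \<and> p \<le> 2 ^ (i + 1)})"
  have finB: "finite (B i)" for i by (rule finite_subset[of _ "{..2 ^ (i + 1)}"]) (auto simp: B_def)
  have block: "(\<Sum>p\<in>B i. 1 / real p) \<le> 4 / real (K + 1)" if "K \<le> i" for i
  proof -
    have "(\<Sum>p\<in>B i. 1 / real p) \<le> (\<Sum>p\<in>B i. 1 / 2 ^ i)"
    proof (rule sum_mono)
      fix p assume "p \<in> B i"
      hence "2 ^ i \<le> p" by (simp add: B_def)
      hence "2 ^ i \<le> real p" by (simp flip: of_nat_le_iff)
      thus "1 / real p \<le> 1 / 2 ^ i" by (intro frac_le) auto
    qed
    also have "\<dots> = real (card (B i)) / 2 ^ i" by simp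
    also have "\<dots> \<le> 4 / real (i + 1)"
      using card_primes_dyadic[of i] by (simp add: B_def field_simps)
    also have "\<dots> \<le> 4 / real (K + 1)" using that by (intro divide_left_mono) auto
    finally show ?thesis .
  qed
  have "{p. prime p \<and> 2 ^ K < p \<and> real p \<le> y} \<subseteq> (\<Union>i\<in>{K..<m + 1}. B i)"
  proof
    fix p assume p: "p \<in> {p. prime p \<and> 2 ^ K < p \<and> real p \<le> y}"
    have p1: "p - 1 > 0" using p prime_gt_1_nat[of p] by auto
    \<comment> \<open>The dyadic intervals are open on the left and closed on the right, so it is
      \<open>p - 1\<close> that is located between powers of 2.\<close>
    have "\<exists>i. 2 ^ i \<le> p - 1 \<and> p - 1 < 2 ^ (i + 1)" by (rule ex_power_ivl1) (use p1 in auto)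
    then obtain i where i: "2 ^ i \<le> p - 1" "p - 1 < 2 ^ (i + 1)" by blast
    have "real p < real (2 ^ (m + 1))" using p y by simp
    hence pm: "p < 2 ^ (m + 1)" by (simp only: of_nat_less_iff)
    have "(2::nat) ^ i < 2 ^ (m + 1)" using i pm by linarith
    hence "i < m + 1" by (rule power_less_imp_less_exp[rotated]) simp
    have "(2::nat) ^ K < 2 ^ (i + 1)" using i p by auto
    hence "K < i + 1" by (rule power_less_imp_less_exp[rotated]) simp
    have "p \<in> B i" using i p p1 by (auto simp: B_def)
    with \<open>i < m + 1\<close> \<open>K < i + 1\<close> show "p \<in> (\<Union>i\<in>{K..<m + 1}. B i)" by auto
  qed
  hence "(\<Sum>p | prime p \<and> 2 ^ K < p \<and> real p \<le> y. 1 / real p) \<le> (\<Sum>p\<in>(\<Union>i\<in>{K..<m + 1}. B i). 1 / real p)"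
    using finB by (intro sum_mono2) auto
  also have "\<dots> = (\<Sum>i\<in>{K..<m + 1}. \<Sum>p\<in>B i. 1 / real p)"
  proof (rule sum.UNION_disjoint)
    have "B i \<inter> B j = {}" if "i < j" for i j
    proof -
      have "(2::nat) ^ (i + 1) \<le> 2 ^ j" using that by (intro power_increasing) auto
      thus ?thesis by (auto simp: B_def)
    qed
    thus "\<forall>i\<in>{K..<m + 1}. \<forall>j\<in>{K..<m + 1}. i \<noteq> j \<longrightarrow> B i \<inter> B j = {}"
      by (metis Int_commute linorder_neqE_nat)
  qed (use finB in auto)
  also have "\<dots> \<le> (\<Sum>i\<in>{K..<m + 1}. 4 / real (K + 1))" by (intro sum_mono block) auto
  also have "\<dots> = 4 * real (m + 1 - K) / real (K + 1)" by simp
  finally show ?thesis .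
qed

lemma norm_short_euler_product:
  "norm (short_euler_product y (1 + \<i> * of_real t)) ^ (2 * k) = euler_block k {p. prime p \<and> real p \<le> y} t"
proof -
  have "of_nat p powr (- (1 + \<i> * of_real t)) = cis (- (t * ln (real p))) / of_nat p" if "prime p" for p :: nat
  proof -
    have p: "real p > 0" using prime_gt_0_nat[OF that] by simp
    have "Ln (of_nat p) = complex_of_real (ln (real p))"
      using Ln_of_real[OF p] by simp
    hence "of_nat p powr (- (1 + \<i> * of_real t)) = exp (- of_real (ln (real p)) + \<i> * of_real (- (t * ln (real p))))"
      using p by (simp add: powr_def algebra_simps)
    also have "\<dots> = exp (of_real (- ln (real p))) * cis (- (t * ln (real p)))"
      by (simp only: exp_add cis_conv_exp of_real_minus)
    also have "exp (complex_of_real (- ln (real p))) = of_real (exp (- ln (real p)))"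
      by (rule exp_of_real)
    also have "exp (- ln (real p)) = 1 / p" using p by (simp add: exp_minus inverse_eq_divide)
    finally show ?thesis by simp
  qed
  thus ?thesis
    by (simp add: short_euler_product_def euler_block_def prod_norm[symmetric] prod_power_distrib)
qed

text \<open>At 1/8 the quadratic Taylor bound is sharp enough to survive the 80th power.\<close>

lemma exp_10_ge: "exp 10 \<ge> (20000::real)"
proof -
  have "1 + 1 / 8 + (1 / 8)\<^sup>2 / 2 \<le> exp (1 / 8 :: real)" by (rule exp_lower_Taylor_quadratic) auto
  hence "(1 + 1 / 8 + (1 / 8)\<^sup>2 / 2) ^ 80 \<le> exp (1 / 8 :: real) ^ 80" by (rule power_mono) auto
  also have "\<dots> = exp 10" by (simp flip: exp_of_nat_mult)
  finally show ?thesis by (rule order_trans[rotated]) (simp add: power2_eq_square power_divide)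
qed

text \<open>All requirements on the size of \<open>T\<close>, with \<open>l = ln (ln T)\<close>. The
  second gives \<open>ln y \<le> 2 * l\<close>, the third absorbs the number of blocks into the
  error, and the last disposes of the ranges where \<open>i\<close> or \<open>K\<close> is below
  about \<open>l / 2\<close>.\<close>

lemma log_size_conditions:
  "eventually (\<lambda>l::real. l \<ge> 1000 \<and> A * ln l \<le> l \<and> l * exp (- (exp l / (2 * l ^ 4))) \<le> 1 \<and>
      2 powr (l / 2) * (200 * l + 200) \<le> exp l / (1000 * l ^ 3)) at_top"
proof (intro eventually_conj)
  show "eventually (\<lambda>l::real. l \<ge> 1000) at_top" by real_asymp
  show "eventually (\<lambda>l. A * ln l \<le> l) at_top" by real_asymp
  show "eventually (\<lambda>l::real. l * exp (- (exp l / (2 * l ^ 4))) \<le> 1) at_top" by real_asymp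
  show "eventually (\<lambda>l::real. 2 powr (l / 2) * (200 * l + 200) \<le> exp l / (1000 * l ^ 3)) at_top" by real_asymp
qed

section \<open>Moments of the blocks\<close>

text \<open>Rankin's gain in the exponent is \<open>Y = w ^ 2 * L / l\<close>. The moments cost a
  Gaussian part, at most \<open>Y / 100\<close>, and a part from the factors
  \<open>108 * k / p\<close>, at most \<open>41 / 100 * Y\<close>; \<open>Y / 2\<close> remains for
  the saving \<open>L / l ^ 4\<close>.\<close>

lemma small_block_moment:
  fixes L l :: real and k K i :: nat
  defines "h \<equiv> K - i"
  assumes l: "l \<ge> 1000" "L = exp l" and grow: "2 powr (l / 2) * (200 * l + 200) \<le> L / (1000 * l ^ 3)"
    and i: "i < K" and K: "2 ^ K \<le> k" "k < 2 ^ (K + 1)" and Kl: "real K \<le> 3 / 2 * l" and k: "40000 * real k \<le> L"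
    and w: "w \<ge> 1 / (16 * l)" "16 * w \<ge> (3 / 4) ^ h" "w \<le> 1 / 8"
  shows "(\<Prod>p | prime p \<and> 2 ^ i < p \<and> p \<le> 2 ^ (i + 1). exp_moment k p (w / l * ln p))
     \<le> exp (- (L / l ^ 4)) * exp (w / l * (w * L)) *
        (\<Prod>p | prime p \<and> 2 ^ i < p \<and> p \<le> 2 ^ (i + 1). fourier_coeff k p 0)"
proof -
  define B where "B = {p::nat. prime p \<and> 2 ^ i < p \<and> p \<le> 2 ^ (i + 1)}"
  have finB: "finite B" by (rule finite_subset[of _ "{..2 ^ (i + 1)}"]) (auto simp: B_def)
  have L: "L > 0" by (simp add: l)
  have "0 < 1 / (16 * l)" using l(1) by simp
  hence w0: "w > 0" using w(1) by linarith
  have hK: "h \<ge> 1" "i + h = K" "real h \<le> 3 / 2 * l" using i Kl by (auto simp: h_def)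
  have kh: "2 ^ i * 2 ^ h \<le> real k" "real k \<le> 2 ^ i * 2 ^ (h + 1)"
  proof -
    have "real (2 ^ K) \<le> real k" using K(1) by (rule of_nat_mono)
    thus "2 ^ i * 2 ^ h \<le> real k" by (simp flip: hK(2) power_add)
    have "real k \<le> real (2 ^ (K + 1))" using K(2) by (intro of_nat_mono) simp
    thus "real k \<le> 2 ^ i * 2 ^ (h + 1)" by (simp flip: hK(2) add: power_add)
  qed
  have card: "real (i + 1) * card B \<le> 4 * 2 ^ i" using card_primes_dyadic[of i] by (simp add: B_def)
  \<comment> \<open>\<open>6 + h\<close> bounds the logarithm of \<open>108 * k / p\<close>. In the
    Gaussian exponent one factor \<open>ln p\<close> is bounded by \<open>l\<close> and the other by
    \<open>i + 1\<close>, which cancels against the prime count of the block.\<close>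
  define X where "X = 6 + real h + 12 * k * (w / l)\<^sup>2 * (l * (i + 1)) / 2 ^ i"
  have factor: "exp_moment k p (w / l * ln p) \<le> exp X * fourier_coeff k p 0" if p: "p \<in> B" for p
  proof -
    have pp: "prime p" and p2: "2 ^ i < p" "p \<le> 2 ^ (i + 1)" using p by (auto simp: B_def)
    have p0: "real p \<ge> 1" using prime_ge_1_nat[OF pp] by simp
    have "2 ^ (i + 1) \<le> (2::nat) ^ K" using i by (intro power_increasing) auto
    hence pk: "p \<le> k" using p2 K by linarith
    have "real p \<le> exp l" using pk k l(2) by linarith
    hence "ln (real p) \<le> ln (exp l)" using p0 by (subst ln_le_cancel_iff) auto
    hence lnl: "ln p \<le> l" by simp
    have ln0: "ln p \<ge> 0" using p0 by simp
    have "real p \<le> real (2 ^ (i + 1))" using p2(2) by (rule of_nat_mono)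
    hence "ln p \<le> ln (2 ^ (i + 1) :: real)" using p0 by simp
    also have "\<dots> = real (i + 1) * ln 2" by (rule ln_realpow)
    also have "\<dots> \<le> real (i + 1) * 1" using ln_2_less_1 by (intro mult_left_mono) auto
    finally have lni: "ln p \<le> i + 1" by simp
    have "w / l * ln p \<le> w / l * l" using lnl w0 l by (intro mult_left_mono) auto
    also have "\<dots> \<le> 1 / 4" using w l by simp
    finally have b: "0 \<le> w / l * ln p" "w / l * ln p \<le> 1 / 4" using ln0 w0 l by auto
    have p2r: "2 ^ i \<le> real p" using p2(1) by (simp flip: of_nat_le_iff)
    have "108 * (k / p) \<le> 108 * (2 ^ i * 2 ^ (h + 1) / 2 ^ i)"
      using kh p2r by (intro mult_left_mono frac_le) auto
    also have "\<dots> = 216 * 2 ^ h" by simp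
    also have "\<dots> \<le> exp 6 * exp 1 ^ h"
    proof (rule mult_mono)
      have "5 / 2 \<le> exp (1::real)" using exp_lower_Taylor_quadratic[of "1::real"] by simp
      hence "(5 / 2) ^ 6 \<le> exp (1::real) ^ 6" by (rule power_mono) simp
      also have "\<dots> = exp 6" by (simp flip: exp_of_nat_mult)
      finally show "216 \<le> exp (6::real)" by (rule order_trans[rotated]) (simp add: power_divide)
      show "2 ^ h \<le> exp (1::real) ^ h" using \<open>5 / 2 \<le> exp 1\<close> by (intro power_mono) auto
    qed auto
    also have "\<dots> = exp (6 + real h)" by (simp add: exp_add flip: exp_of_nat_mult)
    finally have f1: "108 * (k / p) \<le> exp (6 + real h)" .
    have "12 * k * (w / l * ln p)\<^sup>2 / p = 12 * k * (w / l)\<^sup>2 * (ln p * ln p) / p"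
      by (simp add: power_mult_distrib power2_eq_square)
    also have "\<dots> \<le> 12 * k * (w / l)\<^sup>2 * (l * (i + 1)) / 2 ^ i"
      using lnl lni ln0 p2r l by (intro frac_le mult_left_mono mult_mono mult_nonneg_nonneg) auto
    finally have f2: "exp (12 * k * (w / l * ln p)\<^sup>2 / p) \<le> exp (12 * k * (w / l)\<^sup>2 * (l * (i + 1)) / 2 ^ i)"
      by simp
    have "exp_moment k p (w / l * ln p) \<le> fourier_coeff k p 0 * (108 * (k / p) * exp (12 * k * (w / l * ln p)\<^sup>2 / p))"
      using exp_moment_le_small[OF pp pk b] by simp
    also have "\<dots> \<le> fourier_coeff k p 0 * (exp (6 + real h) * exp (12 * k * (w / l)\<^sup>2 * (l * (i + 1)) / 2 ^ i))"
      by (intro mult_left_mono[OF _ fourier_coeff_nonneg] mult_mono f1 f2) auto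
    also have "\<dots> = exp X * fourier_coeff k p 0" by (simp add: X_def flip: exp_add)
    finally show ?thesis .
  qed
  define Y where "Y = w\<^sup>2 * L / l"
  have Y0: "Y > 0" using w0 l L by (simp add: Y_def)
  have kY: "k * w\<^sup>2 / l \<le> Y / 40000"
  proof -
    have "k * (w\<^sup>2 / l) \<le> L / 40000 * (w\<^sup>2 / l)" using k l by (intro mult_right_mono) auto
    thus ?thesis by (simp add: Y_def mult_ac)
  qed
  have Ylow: "Y \<ge> L / (256 * l ^ 3)"
  proof -
    have "(1 / (16 * l))\<^sup>2 \<le> w\<^sup>2" using w l by (intro power_mono) auto
    hence "(1 / (16 * l))\<^sup>2 * (L / l) \<le> w\<^sup>2 * (L / l)" using l L by (intro mult_right_mono) auto
    thus ?thesis by (simp add: Y_def power2_eq_square power3_eq_cube mult_ac)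
  qed
  have quad: "card B * (12 * k * (w / l)\<^sup>2 * (l * (i + 1)) / 2 ^ i) \<le> Y / 100"
  proof -
    have "card B * (12 * k * (w / l)\<^sup>2 * (l * (i + 1)) / 2 ^ i)
        = (real (i + 1) * card B) * (12 * (k * w\<^sup>2 / l) / 2 ^ i)"
      using l by (simp add: power2_eq_square field_simps)
    also have "\<dots> \<le> (4 * 2 ^ i) * (12 * (k * w\<^sup>2 / l) / 2 ^ i)"
      using card l by (intro mult_right_mono) auto
    also have "\<dots> = 48 * (k * w\<^sup>2 / l)" by simp
    also have "\<dots> \<le> 48 * (Y / 40000)" using kY by (intro mult_left_mono) auto
    finally show ?thesis using Y0 by simp
  qed
  have lin: "card B * (6 + real h) \<le> Y * (41 / 100)"
  proof (cases "i + 1 \<ge> l / 2")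
    \<comment> \<open>The prime density saves a factor of order \<open>l\<close>. The cost decays
      like \<open>(9 / 8) ^ h / 2 ^ h\<close>, which is the square of \<open>(3 / 4) ^ h\<close>,
      hence at most \<open>(16 * w) ^ 2\<close>.\<close>
    case True
    have "l / 2 * card B \<le> real (i + 1) * card B" using True by (intro mult_right_mono) auto
    hence cB: "card B \<le> 8 * 2 ^ i / l" using card l by (simp add: field_simps)
    have "6 + real h \<le> 8 * (1 + h * (1 / 8))" by simp
    also have "\<dots> \<le> 8 * (9 / 8) ^ h"
      using Bernoulli_inequality[of "1 / 8 :: real" h] by (intro mult_left_mono) auto
    finally have h8: "6 + real h \<le> 8 * (9 / 8) ^ h" .
    have ik: "2 ^ i \<le> k / 2 ^ h" using kh by (simp add: field_simps)
    have "card B * (6 + real h) \<le> (8 * 2 ^ i / l) * (8 * (9 / 8) ^ h)"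
      using cB h8 l by (intro mult_mono) auto
    also have "\<dots> \<le> (8 * (k / 2 ^ h) / l) * (8 * (9 / 8) ^ h)"
      using ik l by (intro mult_right_mono divide_right_mono mult_left_mono) auto
    also have "\<dots> = 64 * (k / l) * ((3 / 4) ^ h)\<^sup>2"
      by (simp add: power2_eq_square power_divide field_simps flip: power_mult_distrib)
    also have "\<dots> \<le> 64 * (k / l) * (16 * w)\<^sup>2"
      using w l by (intro mult_left_mono power_mono) auto
    also have "\<dots> = 16384 * (k * w\<^sup>2 / l)" by (simp add: power_mult_distrib)
    also have "\<dots> \<le> 16384 * (Y / 40000)" using kY by (intro mult_left_mono) auto
    also have "\<dots> \<le> Y * (41 / 100)" using Y0 by simp
    finally show ?thesis .
  next
    \<comment> \<open>The block has at most \<open>2 powr (l / 2)\<close> primes, so even a trivial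
      count is negligible against \<open>Y \<ge> L / (256 * l ^ 3)\<close>.\<close>
    case False
    have "card B \<le> card {2 ^ i<..2 ^ (i + 1) :: nat}" by (rule card_mono) (auto simp: B_def)
    hence "card B \<le> 2 ^ i" by simp
    hence "real (card B) \<le> real (2 ^ i)" by (rule of_nat_mono)
    also have "\<dots> = 2 powr i" by (simp add: powr_realpow)
    also have "\<dots> \<le> 2 powr (l / 2)" using False by (intro powr_mono) auto
    finally have "card B * (6 + real h) \<le> 2 powr (l / 2) * (200 * l + 200)"
      using hK l by (intro mult_mono) auto
    also have "\<dots> \<le> L / (1000 * l ^ 3)" by (rule grow)
    also have "\<dots> = L / (256 * l ^ 3) * (256 / 1000)" by simp
    also have "\<dots> \<le> Y * (41 / 100)" using Ylow Y0 by (intro mult_mono) auto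
    finally show ?thesis .
  qed
  have tail: "L / l ^ 4 \<le> Y / 2"
  proof -
    have "L / l ^ 4 = L / (256 * l ^ 3) * (256 / l)" by (simp add: power3_eq_cube power4_eq_xxxx)
    also have "\<dots> \<le> Y * (1 / 2)" using Ylow Y0 l L by (intro mult_mono) (auto simp: field_simps)
    finally show ?thesis by simp
  qed
  have "card B * X = card B * (6 + real h) + card B * (12 * k * (w / l)\<^sup>2 * (l * (i + 1)) / 2 ^ i)"
    by (simp add: X_def distrib_left)
  hence main: "card B * X \<le> Y - L / l ^ 4" using quad lin tail Y0 by linarith
  have "(\<Prod>p\<in>B. exp_moment k p (w / l * ln p)) \<le> (\<Prod>p\<in>B. exp X * fourier_coeff k p 0)"
    by (intro prod_mono conjI exp_moment_nonneg factor)
  also have "\<dots> = exp (card B * X) * (\<Prod>p\<in>B. fourier_coeff k p 0)"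
    by (simp add: prod.distrib exp_of_nat_mult)
  also have "\<dots> \<le> exp (Y - L / l ^ 4) * (\<Prod>p\<in>B. fourier_coeff k p 0)"
    using main by (intro mult_right_mono prod_nonneg) (auto simp: fourier_coeff_nonneg)
  also have "exp (Y - L / l ^ 4) = exp (- (L / l ^ 4)) * exp (w / l * (w * L))"
    by (simp add: Y_def power2_eq_square mult_ac flip: exp_add)
  finally show ?thesis by (simp add: B_def)
qed

text \<open>The exponent \<open>1 / (2 * l)\<close> keeps \<open>p powr (1 / (2 * l))\<close> below
  3 up to \<open>y\<close>, so the cost is at most \<open>15 * k\<close> times a sum of
  \<open>1 / p\<close>, of order \<open>ln (y / k) / l\<close> unless \<open>k\<close> is tiny. It
  stays below \<open>7 / 100 * L / l\<close>, while Rankin's gain is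
  \<open>1 / 10 * L / l\<close>.\<close>

lemma large_block_moment:
  fixes L l y :: real and k K :: nat
  assumes l: "l \<ge> 1000" "L = exp l" and grow: "2 powr (l / 2) * (200 * l + 200) \<le> L / (1000 * l ^ 3)"
    and K: "2 ^ K \<le> k" "k < 2 ^ (K + 1)" "K \<ge> 1" and yk: "k \<le> y" "ln y \<le> 2 * l"
    and k: "40000 * real k \<le> L" and kln: "k * ln (y / k) \<le> 7 * L / 20000"
  shows "(\<Prod>p | prime p \<and> 2 ^ K < p \<and> real p \<le> y. exp_moment k p (1 / (2 * l) * ln p))
     \<le> exp (- (L / l ^ 4)) * exp (1 / (2 * l) * (1 / 5 * L)) *
        (\<Prod>p | prime p \<and> 2 ^ K < p \<and> real p \<le> y. fourier_coeff k p 0)"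
proof -
  define B where "B = {p::nat. prime p \<and> 2 ^ K < p \<and> real p \<le> y}"
  have finB: "finite B" by (rule finite_subset[OF _ finite_primes_le[of y]]) (auto simp: B_def)
  have L: "L > 0" by (simp add: l)
  have k0: "real k \<ge> 1"
  proof -
    have "(1::nat) \<le> 2 ^ K" by simp
    hence "1 \<le> k" using K(1) by linarith
    thus ?thesis by simp
  qed
  have factor: "exp_moment k p (1 / (2 * l) * ln p) \<le> exp (15 * k * (1 / p)) * fourier_coeff k p 0"
    if p: "p \<in> B" for p
  proof -
    have pp: "prime p" and p2: "2 ^ K < p" "real p \<le> y" using p by (auto simp: B_def)
    have "(2::nat) ^ 1 \<le> 2 ^ K" using K(3) by (intro power_increasing) auto
    hence "p \<ge> 3" using p2 by simp
    hence p3: "real p \<ge> 3" by simp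
    have "exp 1 \<le> (3::real)" by (rule exp_le)
    hence "ln (exp 1) \<le> ln (real p)" using p3 by (subst ln_le_cancel_iff) auto
    hence ln1: "ln p \<ge> 1" by simp
    define b where "b = 1 / (2 * l) * ln p"
    have b0: "b \<ge> 0" using ln1 l by (simp add: b_def)
    have "ln p \<le> ln y" using p2 p3 by simp
    hence "ln p \<le> 2 * l" using yk by simp
    hence "b \<le> 1" using l by (simp add: b_def field_simps)
    hence "exp b \<le> exp 1" by simp
    hence eb: "exp b \<le> 3" using exp_le by linarith
    \<comment> \<open>The bound \<open>exp b \<le> 3\<close> is too weak at \<open>p = 3\<close>;
      instead \<open>exp b / p\<close> is at most \<open>exp (- (3 / 4) * ln p)\<close> with
      \<open>ln p \<ge> 1\<close>.\<close>
    have "b \<le> ln p / 4" using ln1 l by (simp add: b_def field_simps)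
    hence "exp b \<le> exp (ln p / 4)" by simp
    also have "\<dots> = p * exp (- (3 / 4) * ln p)"
    proof -
      have "exp (ln p / 4) = exp (ln p) * exp (- (3 / 4) * ln p)" by (simp flip: exp_add)
      thus ?thesis using p3 by simp
    qed
    also have "\<dots> \<le> p * exp (- (3 / 4))" using ln1 p3 by (intro mult_left_mono) auto
    also have "exp (- (3 / 4)) \<le> (3 / 5 :: real)"
    proof -
      have "5 / 3 \<le> exp (3 / 4 :: real)"
        using exp_lower_Taylor_quadratic[of "3 / 4 :: real"] by (simp add: power2_eq_square)
      thus ?thesis by (simp add: exp_minus field_simps)
    qed
    finally have "exp b / p \<le> 3 / 5" using p3 by (simp add: field_simps)
    from exp_moment_le_large[OF pp b0 this, of k]
    have "exp_moment k p b \<le> fourier_coeff k p 0 * exp (5 * k * exp b / p)" by simp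
    also have "\<dots> \<le> fourier_coeff k p 0 * exp (15 * k * (1 / p))"
    proof (rule mult_left_mono[OF _ fourier_coeff_nonneg])
      have "5 * real k * exp b \<le> 5 * real k * 3" by (rule mult_left_mono[OF eb]) simp
      hence "5 * real k * exp b / p \<le> 5 * real k * 3 / p" by (rule divide_right_mono) simp
      thus "exp (5 * k * exp b / p) \<le> exp (15 * k * (1 / p))" by simp
    qed
    finally show ?thesis by (simp add: b_def mult.commute)
  qed
  define s where "s = (\<Sum>p\<in>B. 1 / real p)"
  have y1: "y \<ge> 1" using yk k0 by linarith
  define n where "n = nat \<lfloor>y\<rfloor>"
  have n: "n \<ge> 1" "n \<ge> k" "real n \<le> y" "y < real n + 1"
    using y1 yk by (auto simp: n_def le_nat_floor; linarith)+
  have "\<exists>m. 2 ^ m \<le> n \<and> n < 2 ^ (m + 1)" by (rule ex_power_ivl1) (use n in auto)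
  then obtain m where m: "2 ^ m \<le> n" "n < 2 ^ (m + 1)" by blast
  have "n + 1 \<le> 2 ^ (m + 1)" using m by simp
  hence "real (n + 1) \<le> real (2 ^ (m + 1))" by (rule of_nat_mono)
  hence ym: "y < 2 ^ (m + 1)" using n by simp
  have s: "s \<le> 4 * real (m + 1 - K) / real (K + 1)"
    unfolding s_def B_def by (rule sum_reciprocal_primes_le[OF ym])
  have "(2::nat) ^ K < 2 ^ (m + 1)" using K(1) n m by linarith
  hence "K < m + 1" by (rule power_less_imp_less_exp[rotated]) simp
  hence mK: "real (m + 1 - K) = real m + 1 - real K" by (simp add: of_nat_diff)
  have "(2::real) ^ m = real (2 ^ m)" by simp
  also have "\<dots> \<le> real n" using m by (intro of_nat_mono)
  also have "\<dots> \<le> y" by (rule n)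
  finally have "2 ^ m \<le> y" .
  hence "ln (2 ^ m) \<le> ln y" using y1 by (subst ln_le_cancel_iff) auto
  hence lm: "m * ln 2 \<le> ln y" by (simp add: ln_realpow)
  have "real k \<le> real (2 ^ (K + 1))" using K by (intro of_nat_mono) simp
  hence "ln (real k) \<le> ln (2 ^ (K + 1))" using k0 by simp
  also have "\<dots> = real (K + 1) * ln 2" by (rule ln_realpow)
  finally have lK: "ln k \<le> (K + 1) * ln 2" .
  have lyk: "ln (y / k) = ln y - ln k" "ln (y / k) \<ge> 0" using y1 k0 yk by (auto simp: ln_div)
  have mk2: "(real m - K - 1) * ln 2 \<le> ln (y / k)"
    using lm lK lyk by (simp add: algebra_simps)
  \<comment> \<open>With the two extra intervals, the number of dyadic intervals between
    \<open>2 ^ K\<close> and \<open>y\<close> is at most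
    \<open>2 + 3 / 2 * ln (y / k)\<close>.\<close>
  have mk: "real m - K - 1 \<le> 3 / 2 * ln (y / k)"
  proof (cases "real m - K - 1 \<ge> 0")
    case True
    hence "(real m - K - 1) * (2 / 3) \<le> (real m - K - 1) * ln 2"
      using ln2_ge_two_thirds by (intro mult_left_mono)
    with mk2 have "(real m - K - 1) * (2 / 3) \<le> ln (y / k)" by linarith
    thus ?thesis by simp
  next
    case False
    have "0 \<le> 3 / 2 * ln (y / k)" using lyk(2) by simp
    thus ?thesis using False by linarith
  qed
  have s2: "15 * k * s \<le> L / l * (7 / 100)"
  proof (cases "K + 1 \<ge> l / 2")
    case True
    have "s \<le> 4 * (2 + 3 / 2 * ln (y / k)) / real (K + 1)"
      by (rule order_trans[OF s]) (use mk mK in \<open>auto intro!: divide_right_mono\<close>)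
    also have "\<dots> \<le> 4 * (2 + 3 / 2 * ln (y / k)) / (l / 2)"
      using True l lyk by (intro divide_left_mono) auto
    finally have "15 * k * s \<le> 15 * k * (4 * (2 + 3 / 2 * ln (y / k)) / (l / 2))"
      by (intro mult_left_mono) auto
    also have "\<dots> = (240 * k + 180 * (k * ln (y / k))) / l" using l by (simp add: field_simps)
    also have "\<dots> \<le> (240 * (L / 40000) + 180 * (7 * L / 20000)) / l"
      using k kln l by (intro divide_right_mono add_mono mult_left_mono) auto
    also have "\<dots> \<le> L / l * (7 / 100)" using l L by (simp add: field_simps)
    finally show ?thesis .
  next
    \<comment> \<open>Now \<open>k\<close> is at most \<open>2 powr (l / 2)\<close>, and the trivial
      bound \<open>4 * (3 * l + 1)\<close> for the sum suffices.\<close>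
    case False
    have "real k \<le> real (2 ^ (K + 1))" using K by (intro of_nat_mono) simp
    also have "\<dots> = 2 powr real (K + 1)" by (subst powr_realpow) auto
    also have "\<dots> \<le> 2 powr (l / 2)" using False by (intro powr_mono) auto
    finally have k2: "real k \<le> 2 powr (l / 2)" .
    have "real m * (2 / 3) \<le> m * ln 2" using ln2_ge_two_thirds by (intro mult_left_mono) auto
    hence ml: "real m \<le> 3 * l" using lm yk by simp
    have "s \<le> 4 * (3 * l + 1) / 1"
      by (rule order_trans[OF s]) (use ml mK l in \<open>intro frac_le, auto\<close>)
    hence "15 * k * s \<le> 15 * 2 powr (l / 2) * (12 * l + 4)"
      using k2 l by (intro mult_mono) (auto simp: s_def intro!: sum_nonneg)
    also have "\<dots> \<le> 2 powr (l / 2) * (200 * l + 200)" using l by simp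
    also have "\<dots> \<le> L / (1000 * l ^ 3)" by (rule grow)
    also have "\<dots> = L / l * (1 / (1000 * l\<^sup>2))" by (simp add: power2_eq_square power3_eq_cube)
    also have "\<dots> \<le> L / l * (7 / 100)"
    proof (intro mult_left_mono)
      have "1 \<le> l\<^sup>2" using l by simp
      hence "1 / (1000 * l\<^sup>2) \<le> 1 / 1000" by (intro frac_le) auto
      thus "1 / (1000 * l\<^sup>2) \<le> 7 / 100" by simp
    qed (use l L in auto)
    finally show ?thesis .
  qed
  have tail: "L / l ^ 4 \<le> L / l * (1 / 100)"
  proof -
    have "100 * 1 \<le> l * l ^ 2" using l by (intro mult_mono one_le_power) auto
    hence "100 \<le> l ^ 3" by (simp add: power2_eq_square power3_eq_cube)
    hence "L / l * (1 / l ^ 3) \<le> L / l * (1 / 100)" using l L by (intro mult_left_mono frac_le) auto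
    thus ?thesis by (simp add: power3_eq_cube power4_eq_xxxx)
  qed
  have "L / l > 0" using L l by simp
  hence main: "15 * k * s \<le> 1 / (2 * l) * (1 / 5 * L) - L / l ^ 4" using s2 tail by simp
  have "(\<Prod>p\<in>B. exp_moment k p (1 / (2 * l) * ln p)) \<le> (\<Prod>p\<in>B. exp (15 * k * (1 / p)) * fourier_coeff k p 0)"
    by (intro prod_mono conjI exp_moment_nonneg factor)
  also have "\<dots> = exp (15 * k * s) * (\<Prod>p\<in>B. fourier_coeff k p 0)"
    using finB by (simp add: prod.distrib s_def sum_distrib_left exp_sum)
  also have "\<dots> \<le> exp (1 / (2 * l) * (1 / 5 * L) - L / l ^ 4) * (\<Prod>p\<in>B. fourier_coeff k p 0)"
    using main by (intro mult_right_mono prod_nonneg) (auto simp: fourier_coeff_nonneg)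
  also have "exp (1 / (2 * l) * (1 / 5 * L) - L / l ^ 4) = exp (- (L / l ^ 4)) * exp (1 / (2 * l) * (1 / 5 * L))"
    by (simp flip: exp_add)
  finally show ?thesis by (simp add: B_def)
qed

section \<open>The mean value of the Euler product\<close>

lemma dyadic_blocks:
  fixes y :: real and K :: nat
  assumes "2 ^ K \<le> y"
  defines "B \<equiv> \<lambda>i. if i < K then {p::nat. prime p \<and> 2 ^ i < p \<and> p \<le> 2 ^ (i + 1)}
                   else {p. prime p \<and> 2 ^ K < p \<and> real p \<le> y}"
  shows "disjoint_family_on B {..K}" and "(\<Union>i\<le>K. B i) = {p. prime p \<and> real p \<le> y}"
    and "finite (B i)"
proof -
  show "finite (B i)"
    by (rule finite_subset[of _ "{..2 ^ (i + 1)} \<union> {p. prime p \<and> real p \<le> y}"])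
       (auto simp: B_def finite_primes_le)
  have "B i \<inter> B j = {}" if "i < j" "j \<le> K" for i j
  proof -
    have "(2::nat) ^ (i + 1) \<le> 2 ^ j" using that by (intro power_increasing) auto
    thus ?thesis using that by (auto simp: B_def)
  qed
  thus "disjoint_family_on B {..K}"
    unfolding disjoint_family_on_def by (metis Int_commute atMost_iff linorder_neqE_nat)
  show "(\<Union>i\<le>K. B i) = {p. prime p \<and> real p \<le> y}"
  proof (intro equalityI subsetI)
    fix p assume "p \<in> (\<Union>i\<le>K. B i)"
    then obtain i where i: "i \<le> K" "p \<in> B i" by blast
    show "p \<in> {p. prime p \<and> real p \<le> y}"
    proof (cases "i < K")
      case True
      hence "(2::nat) ^ (i + 1) \<le> 2 ^ K" by (intro power_increasing) auto
      hence "p \<le> 2 ^ K" using i True by (auto simp: B_def)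
      hence "real p \<le> real (2 ^ K)" by (rule of_nat_mono)
      also have "\<dots> = 2 ^ K" by simp
      finally have "real p \<le> y" using assms(1) by (rule order_trans)
      thus ?thesis using i True assms(1) by (auto simp: B_def)
    qed (use i in \<open>auto simp: B_def\<close>)
  next
    fix p assume p: "p \<in> {p. prime p \<and> real p \<le> y}"
    show "p \<in> (\<Union>i\<le>K. B i)"
    proof (cases "2 ^ K < p")
      case False
      have p1: "1 \<le> p - 1" using p prime_gt_1_nat[of p] by auto
      have "\<exists>i. 2 ^ i \<le> p - 1 \<and> p - 1 < 2 ^ (i + 1)" by (rule ex_power_ivl1) (use p1 in auto)
      then obtain i where i: "2 ^ i \<le> p - 1" "p - 1 < 2 ^ (i + 1)" by blast
      have "(2::nat) ^ i < 2 ^ K" using i p1 False by linarith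
      hence "i < K" by (rule power_less_imp_less_exp[rotated]) simp
      thus ?thesis using i p p1 by (auto simp: B_def intro!: bexI[of _ i])
    qed (use p in \<open>auto simp: B_def intro!: bexI[of _ K]\<close>)
  qed
qed

text \<open>Fixes all parameters: blocks, truncation weights, Rankin exponents and the error
  \<open>\<epsilon>\<close> per block. The constant 16 is the 8 of the sandwich times 2, from at
  most \<open>2 * l\<close> as the block count.\<close>

lemma short_euler_product_mean:
  fixes T y l L A :: real and k :: nat
  assumes T: "T > 0" and L: "ln T = L" and l: "ln L = l" "l \<ge> 1000" "L = exp l"
    and A: "A * ln l \<le> l"
    and small: "l * exp (- (L / (2 * l ^ 4))) \<le> 1"
    and grow: "2 powr (l / 2) * (200 * l + 200) \<le> L / (1000 * l ^ 3)"
    and y: "exp 2 * L \<le> y" "y \<le> L * l powr A"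
    and k: "2 \<le> k" "real k \<le> L / (exp 10 * ln (y / L))"
  shows "\<bar>integral {T..2*T} (\<lambda>t. norm (short_euler_product y (1 + \<i> * of_real t)) ^ (2 * k)) / T
            - friable_divisor_sum k y\<bar> \<le> 16 * exp (- (L / (2 * l ^ 4))) * friable_divisor_sum k y"
proof -
  have L0: "L > 0" by (simp add: l)
  have Ll: "L \<ge> l" using exp_ge_add_one_self[of l] unfolding l(3) by linarith
  have y0: "y > 0" using y(1) L0 by (meson exp_gt_zero less_le_trans mult_pos_pos)
  define \<rho> where "\<rho> = ln (y / L)"
  have "ln (exp 2) \<le> \<rho>" unfolding \<rho>_def using y L0 y0 by (subst ln_le_cancel_iff) (auto simp: field_simps)
  hence lam: "\<rho> \<ge> 2" by simp
  have k0: "real k \<ge> 2" using k by simp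
  \<comment> \<open>In terms of \<open>\<mu>\<close> the upper bound for \<open>k\<close> reads
    \<open>\<rho> \<le> \<mu>\<close>, and \<open>y \<ge> exp 2 * L\<close> gives
    \<open>\<rho> \<ge> 2\<close>. With \<open>exp 10 \<ge> 20000\<close> this yields
    \<open>k \<le> L / 40000\<close>.\<close>
  define \<mu> where "\<mu> = L / (exp 10 * k)"
  have mu: "\<rho> \<le> \<mu>"
    using k(2) lam k0 by (simp add: \<mu>_def field_simps flip: \<rho>_def)
  have kmu: "exp 10 * (k * \<mu>) = L" using k0 by (simp add: \<mu>_def)
  have kL: "20000 * (k * \<mu>) \<le> L"
    using mult_right_mono[OF exp_10_ge, of "k * \<mu>"] kmu mu lam by simp
  have "2 \<le> \<mu>" using mu lam by linarith
  hence "real k * 2 \<le> real k * \<mu>" by (intro mult_left_mono) auto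
  hence k40: "40000 * real k \<le> L" using kL by linarith
  have "L * 1 \<le> L * exp 2" using L0 by (intro mult_left_mono) auto
  hence "L \<le> y" using y(1) by (simp add: mult.commute)
  hence ky: "real k \<le> y" using k40 by linarith
  have kln: "k * ln (y / k) \<le> 7 * L / 20000"
  proof -
    have "y / k = (y / L) * (exp 10 * \<mu>)" using L0 k0 by (simp add: \<mu>_def)
    hence "ln (y / k) = ln ((y / L) * (exp 10 * \<mu>))" by simp
    also have "\<dots> = ln (y / L) + ln (exp 10 * \<mu>)"
      by (rule ln_mult_pos) (use y0 L0 mu lam in auto)
    also have "ln (exp 10 * \<mu>) = ln (exp 10) + ln \<mu>"
      by (rule ln_mult_pos) (use mu lam in auto)
    also have "ln (y / L) + (ln (exp 10) + ln \<mu>) = \<rho> + (10 + ln \<mu>)" by (simp add: \<rho>_def)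
    \<comment> \<open>The summands \<open>\<rho>\<close>, 10 and \<open>ln \<mu>\<close> are at most
      \<open>\<mu>\<close>, \<open>5 * \<mu>\<close> and \<open>\<mu>\<close>.\<close>
    also have "\<dots> \<le> 7 * \<mu>" using mu lam ln_le_minus_one[of \<mu>] by linarith
    finally have "k * ln (y / k) \<le> k * (7 * \<mu>)" by (intro mult_left_mono) auto
    also have "\<dots> \<le> 7 * L / 20000" using kL by linarith
    finally show ?thesis .
  qed
  have lny: "ln y \<le> 2 * l"
  proof -
    have "ln y \<le> ln (L * l powr A)" using y y0 by (subst ln_le_cancel_iff) auto
    also have "\<dots> = l + A * ln l" using l L0 by (simp add: ln_mult ln_powr)
    finally show ?thesis using A by linarith
  qed
  have "\<exists>K. 2 ^ K \<le> k \<and> k < 2 ^ (K + 1)" by (rule ex_power_ivl1) (use k in auto)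
  then obtain K where K: "2 ^ K \<le> k" "k < 2 ^ (K + 1)" by blast
  have "(2::nat) ^ 1 < 2 ^ (K + 1)" using K k by simp
  hence "1 < K + 1" by (rule power_less_imp_less_exp[rotated]) simp
  hence K1: "K \<ge> 1" by simp
  have "real (2 ^ K) \<le> real k" using K by (intro of_nat_mono)
  hence Kk: "2 ^ K \<le> real k" by simp
  have Kl: "real K \<le> 3 / 2 * l"
  proof -
    have "real K * (2 / 3) \<le> K * ln 2" using ln2_ge_two_thirds by (intro mult_left_mono) auto
    also have "\<dots> = ln (2 ^ K)" by (simp add: ln_realpow)
    also have "\<dots> \<le> ln L"
    proof -
      have "2 ^ K \<le> L" using Kk k40 k0 by linarith
      thus ?thesis using L0 by (subst ln_le_cancel_iff) auto
    qed
    finally show ?thesis using l by simp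
  qed
  define B where "B = (\<lambda>i. if i < K then {p::nat. prime p \<and> 2 ^ i < p \<and> p \<le> 2 ^ (i + 1)}
                   else {p. prime p \<and> 2 ^ K < p \<and> real p \<le> y})"
  have Ky: "2 ^ K \<le> y" using Kk ky by linarith
  note B = dyadic_blocks(1,2)[OF Ky, folded B_def]
  have finB: "finite (B i)" for i unfolding B_def by (rule dyadic_blocks(3)[OF Ky])
  \<comment> \<open>Block \<open>i\<close> has at most \<open>2 ^ i\<close> primes, which costs a factor that decays like \<open>2 ^ (i - K)\<close> in the
    exponent, against a gain of order \<open>(w i)\<^sup>2\<close>; hence a ratio with \<open>(3 / 4)\<^sup>2 > 1 / 2\<close>. The constant
    part keeps a gain of order \<open>L / l ^ 3\<close> in the lowest blocks.\<close>
  define w where "w = (\<lambda>i. if i < K then (3 / 4) ^ (K - i) / 16 + 1 / (16 * l) else 1 / 5)"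
  \<comment> \<open>In a small block \<open>a = w / l\<close> makes gain and Gaussian cost both
    proportional to \<open>w ^ 2\<close>, so their ratio depends only on \<open>k / L\<close>. In
    the last block \<open>a * ln p \<le> 1\<close> because \<open>ln y \<le> 2 * l\<close>.\<close>
  define a where "a = (\<lambda>i. if i < K then w i / l else 1 / (2 * l))"
  define \<epsilon> where "\<epsilon> = exp (- (L / l ^ 4))"
  have w0: "w i \<ge> 0" for i using l by (auto simp: w_def)
  have w1: "w i \<le> 1 / 8" if "i < K" for i
  proof -
    have "(3 / 4) ^ (K - i) \<le> (1::real)" by (intro power_le_one) auto
    moreover have "1 / (16 * l) \<le> 1 / 16" using l by simp
    ultimately show ?thesis using that by (simp add: w_def)
  qed
  \<comment> \<open>The budget: 3/16 from the geometric series, 3/32 from the constant part since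
    \<open>K \<le> 3 / 2 * l\<close>, and 1/5 for the last block.\<close>
  have wsum: "(\<Sum>i\<le>K. w i) \<le> 1 / 2"
  proof -
    have "(\<Sum>i<K. (3 / 4) ^ (K - i)) = (\<Sum>j<K. (3 / 4) ^ (j + 1) :: real)"
      by (rule sum.reindex_bij_witness[where i = "\<lambda>j. K - Suc j" and j = "\<lambda>i. K - Suc i"])
         (auto simp: Suc_diff_Suc)
    also have "\<dots> = 3 / 4 * (\<Sum>j<K. (3 / 4) ^ j)" by (simp add: sum_distrib_left)
    also have "\<dots> = 3 * (1 - (3 / 4) ^ K)" by (subst sum_gp_strict) auto
    also have "\<dots> \<le> 3" by simp
    finally have g: "(\<Sum>i<K. (3 / 4) ^ (K - i)) \<le> (3::real)" .
    have "(\<Sum>i\<le>K. w i) = (\<Sum>i<K. w i) + 1 / 5"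
      by (simp add: w_def lessThan_Suc_atMost[symmetric])
    also have "(\<Sum>i<K. w i) = (\<Sum>i<K. (3 / 4) ^ (K - i)) / 16 + K / (16 * l)"
      by (simp add: w_def sum.distrib sum_divide_distrib)
    also have "K / (16 * l) \<le> 3 / 32" using Kl l by (simp add: field_simps)
    finally show ?thesis using g by linarith
  qed
  \<comment> \<open>Half of the saving pays for the factor \<open>l\<close> from the number of
    blocks; this is the origin of the 2 in the final exponent.\<close>
  have e2: "exp (- (L / l ^ 4)) = exp (- (L / (2 * l ^ 4))) * exp (- (L / (2 * l ^ 4)))"
    by (simp flip: exp_add)
  have le: "l * \<epsilon> \<le> exp (- (L / (2 * l ^ 4)))"
    using mult_right_mono[OF small, of "exp (- (L / (2 * l ^ 4)))"] by (simp add: \<epsilon>_def e2)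
  have K2: "real (card {..K} + 1) \<le> 2 * l" using Kl l by simp
  have "\<bar>integral {T..2*T} (\<lambda>t. \<Prod>i\<le>K. euler_block k (B i) t) / T - (\<Prod>i\<le>K. \<Prod>p\<in>B i. fourier_coeff k p 0)\<bar>
           \<le> 8 * real (card {..K} + 1) * \<epsilon> * (\<Prod>i\<le>K. \<Prod>p\<in>B i. fourier_coeff k p 0)"
  proof (rule euler_product_mean[where a = a and W = "\<lambda>i. w i * L"])
    show "prime p" if "p \<in> B i" for i p using that by (auto simp: B_def split: if_splits)
    show "0 \<le> a i \<and> a i \<le> 1 / 4" for i
    proof (cases "i < K")
      case True
      have "w i / l \<le> (1 / 8) / 1" using w1[OF True] l by (intro frac_le) auto
      thus ?thesis using True w0[of i] l by (simp add: a_def)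
    qed (use l in \<open>simp add: a_def field_simps\<close>)
    show "w i * L \<ge> 0" for i using w0 L0 by simp
    have "(\<Sum>i\<le>K. w i * L) = (\<Sum>i\<le>K. w i) * L" by (simp add: sum_distrib_right)
    also have "\<dots> \<le> 1 / 2 * L" using wsum L0 by (intro mult_right_mono) auto
    finally show "(\<Sum>i\<le>K. w i * L) \<le> ln T / 2" by (simp add: L)
    show "\<epsilon> > 0" by (simp add: \<epsilon>_def)
    have "exp (- (L / (2 * l ^ 4))) \<le> 1 / l" using small l by (simp add: field_simps)
    also have "\<dots> \<le> 1 / 2" using l by (intro frac_le) auto
    finally have "2 * (l * \<epsilon>) \<le> 1" using le by linarith
    moreover have "real (card {..K} + 1) * \<epsilon> \<le> 2 * l * \<epsilon>"
      using K2 by (intro mult_right_mono) (auto simp: \<epsilon>_def)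
    ultimately show "real (card {..K} + 1) * \<epsilon> \<le> 1" by linarith
    have "1 \<le> l ^ 4" using l by (intro one_le_power) auto
    have "8 * 1 \<le> l * l ^ 3" using l by (intro mult_mono one_le_power) auto
    hence "8 \<le> l ^ 4" by (simp add: power3_eq_cube power4_eq_xxxx)
    hence "L / l ^ 4 \<le> L / 8" using L0 by (intro frac_le) auto
    hence "ln 2 + L / l ^ 4 \<le> 3 / 8 * L" using ln_2_less_1 Ll l by linarith
    hence "exp (ln 2 + - (3 / 8) * ln T) \<le> exp (- (L / l ^ 4))" unfolding exp_le_cancel_iff L by linarith
    thus "2 * exp (- (3 / 8) * ln T) \<le> \<epsilon>" unfolding \<epsilon>_def exp_add by simp
    show "(\<Prod>p\<in>B i. exp_moment k p (a i * ln p))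
        \<le> \<epsilon> * exp (a i * (w i * L)) * (\<Prod>p\<in>B i. fourier_coeff k p 0)" if "i \<in> {..K}" for i
    proof (cases "i < K")
      case True
      have "(3 / 4) ^ (K - i) \<le> 16 * w i" "1 / (16 * l) \<le> w i" using True l by (auto simp: w_def)
      from small_block_moment[OF l(2,3) grow True K Kl k40 this(2,1) w1[OF True]]
      show ?thesis using True by (simp add: B_def a_def \<epsilon>_def)
    next
      case False
      from large_block_moment[OF l(2,3) grow K K1 ky lny k40 kln]
      show ?thesis using False by (simp add: B_def a_def \<epsilon>_def w_def)
    qed
  qed (use B finB T in auto)
  also have "(\<Prod>i\<le>K. \<Prod>p\<in>B i. fourier_coeff k p 0) = friable_divisor_sum k y"
    unfolding friable_divisor_sum_eq B(2)[symmetric]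
    using B finB by (subst prod.UNION_disjoint) (auto simp: disjoint_family_on_def)
  also have "(\<lambda>t. \<Prod>i\<le>K. euler_block k (B i) t) =
      (\<lambda>t. norm (short_euler_product y (1 + \<i> * of_real t)) ^ (2 * k))"
    unfolding norm_short_euler_product B(2)[symmetric] euler_block_def
    using B finB by (subst prod.UNION_disjoint) (auto simp: disjoint_family_on_def)
  also have "8 * real (card {..K} + 1) * \<epsilon> * friable_divisor_sum k y
      \<le> 16 * exp (- (L / (2 * l ^ 4))) * friable_divisor_sum k y"
  proof (rule mult_right_mono)
    have "8 * real (card {..K} + 1) * \<epsilon> \<le> 8 * (2 * l) * \<epsilon>"
      using K2 by (intro mult_right_mono mult_left_mono) (auto simp: \<epsilon>_def)
    thus "8 * real (card {..K} + 1) * \<epsilon> \<le> 16 * exp (- (L / (2 * l ^ 4)))" using le by linarith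
    show "friable_divisor_sum k y \<ge> 0"
      unfolding friable_divisor_sum_eq by (intro prod_nonneg ballI fourier_coeff_nonneg)
  qed
  finally show ?thesis .
qed

theorem proposition4p1:
  fixes A :: real
  assumes "A > 0"
  shows "\<exists>T\<^sub>0 C :: real. \<forall>(T::real) (y::real) (k::nat).
           T \<ge> T\<^sub>0 \<and>
           exp 2 * ln T \<le> y \<and> y \<le> ln T * ln (ln T) powr A \<and>
           2 \<le> k \<and> real k \<le> ln T / (exp 10 * ln (y / ln T)) \<longrightarrow>
           (\<exists>E. (1 / T) * integral {T..2*T} (\<lambda>t. norm (short_euler_product y (1 + \<i> * of_real t)) ^ (2 * k))
                  = friable_divisor_sum k y * (1 + E) \<and>
                \<bar>E\<bar> \<le> C * exp (- (ln T / (2 * ln (ln T) ^ 4))))"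
proof -
  obtain l\<^sub>0 where l\<^sub>0: "\<And>l. l \<ge> l\<^sub>0 \<Longrightarrow> l \<ge> 1000 \<and> A * ln l \<le> l \<and> l * exp (- (exp l / (2 * l ^ 4))) \<le> 1 \<and>
      2 powr (l / 2) * (200 * l + 200) \<le> exp l / (1000 * l ^ 3)"
    using log_size_conditions[of A] unfolding eventually_at_top_linorder by blast
  show ?thesis
  \<comment> \<open>This threshold makes \<open>ln (ln T) \<ge> l\<^sub>0\<close>; it depends on
    \<open>A\<close> alone, and the constant 16 is absolute.\<close>
  proof (rule exI[where x = "exp (exp l\<^sub>0)"], rule exI[where x = 16], intro allI impI)
    fix T y :: real and k :: nat
    assume *: "exp (exp l\<^sub>0) \<le> T \<and> exp 2 * ln T \<le> y \<and> y \<le> ln T * ln (ln T) powr A \<and>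
           2 \<le> k \<and> real k \<le> ln T / (exp 10 * ln (y / ln T))"
    define D where "D = friable_divisor_sum k y"
    define M where "M = (1 / T) * integral {T..2*T} (\<lambda>t. norm (short_euler_product y (1 + \<i> * of_real t)) ^ (2 * k))"
    have T: "T > 0" using * by (auto intro: less_le_trans[OF exp_gt_zero])
    have L: "exp l\<^sub>0 \<le> ln T" using * T by (simp add: ln_ge_iff)
    hence L0: "ln T > 0" by (rule less_le_trans[OF exp_gt_zero])
    have "l\<^sub>0 \<le> ln (ln T)" using L L0 by (simp add: ln_ge_iff)
    note cond = l\<^sub>0[OF this]
    have D: "D > 0"
      unfolding D_def friable_divisor_sum_eq using fourier_coeff_0_ge_1
      by (intro prod_pos) (auto intro: less_le_trans[OF zero_less_one])
    have "\<bar>M - D\<bar> \<le> 16 * exp (- (ln T / (2 * ln (ln T) ^ 4))) * D"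
      using short_euler_product_mean[OF T refl refl, of A y k] cond * L0 by (simp add: M_def D_def)
    hence "\<bar>M - D\<bar> / D \<le> 16 * exp (- (ln T / (2 * ln (ln T) ^ 4)))"
      using D by (simp add: pos_divide_le_eq)
    moreover have "\<bar>M / D - 1\<bar> = \<bar>M - D\<bar> / D" using D by (simp add: abs_divide diff_divide_distrib[symmetric] divide_diff_eq_iff field_simps)
    ultimately have "M = D * (1 + (M / D - 1)) \<and> \<bar>M / D - 1\<bar> \<le> 16 * exp (- (ln T / (2 * ln (ln T) ^ 4)))"
      using D by simp
    thus "\<exists>E. (1 / T) * integral {T..2*T} (\<lambda>t. norm (short_euler_product y (1 + \<i> * of_real t)) ^ (2 * k))
                  = friable_divisor_sum k y * (1 + E) \<and>
                \<bar>E\<bar> \<le> 16 * exp (- (ln T / (2 * ln (ln T) ^ 4)))"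
      unfolding M_def D_def by blast
  qed
qed

end
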